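(* Let $i\neq j$ be two indices in $\{1,2,3\}$ and suppose that $P_i(a,b,c)=0$ and $P_j(a,b,c)=0$. Then the number and the geometry of the 1-Weierstrass points of the quartic $C_{a,b,c}$ are given by one of the following: (i) $16$ ordinary flexes, forming four $H$-orbits of $4$ points each, and $4$ hyperflexes, forming two $H$-orbits of $2$ points each; (ii) $8$ ordinary flexes, forming two $H$-orbits of $4$ points each, and $8$ hyperflexes, forming two $H$-orbits of $2$ points each and one $H$-orbit of $4$ points; (iii) $0$ ordinary flexes, and $12$ hyperflexes, forming two $H$-orbits of $2$ points each and two $H$-orbits of $4$ points each.
   Context: All curves are over $\mathbb{C}$. For parameters $a,b,c\in\mathbb{C}$ with $(a^2-1)(b^2-1)(c^2-1)(a^2-4)(b^2-4)(c^2-4)(a^2+b^2+c^2-abc-4)\neq 0$, let $C_{a,b,c}\subset\mathbb{P}^2$ be the smooth plane quartic $x^4+y^4+z^4+ax^2y^2+bx^2z^2+cy^2z^2=0$. This condition on the parameters is assumed throughout. Put $P_1(a,b,c)=a^2+b^2-abc$, $P_2(a,b,c)=a^2+c^2-abc$, $P_3(a,b,c)=b^2+c^2-abc$. Let $H\cong C_2\times C_2$ be the group of projective transformations generated by $\sigma=\mathrm{diag}(-1,1,1)$ and $\tau=\mathrm{diag}(1,-1,1)$; it acts on $C_{a,b,c}$, and orbits are taken under this action. The 1-Weierstrass points of a smooth plane quartic $C$ (Weierstrass points with respect to the canonical divisor) are exactly its flexes, i.e. the points $p$ where the tangent line meets $C$ at $p$ with contact order at least $3$. A flex is an ordinary flex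 if the contact order is exactly $3$, and a hyperflex if it is $4$.
   Formalization: The parameters (a,b,c) = (0,0,0) are excluded: there the curve is the Fermat quartic, whose 12 hyperflexes form six H-orbits of 2 points each, so none of (i), (ii), (iii) holds. *)

theory Defs
  imports
    "HOL-Analysis.Analysis"
    "HOL-Algebra.Bij"
    "HOL-Algebra.Group_Action"
    "HOL-Algebra.Generated_Groups"
    "HOL-Computational_Algebra.Polynomial"
    "HOL-Library.Multiset"
begin

section \<open>The projective plane and its transformations\<close>

text \<open>A point of the complex projective plane is a one-dimensional subspace of \<open>\<complex>\<^sup>3\<close>, a line is a
  two-dimensional one.  The library's \<^const>\<open>vec.span\<close> is the span over the complex scalars.\<close>

type_synonym ppoint = "(complex ^ 3) set"

definition proj_plane :: "ppoint set" where
  "proj_plane = {vec.span {v} | v. v \<noteq> 0}"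

definition proj_map :: "complex ^ 3 ^ 3 \<Rightarrow> ppoint \<Rightarrow> ppoint" where
  "proj_map A = (\<lambda>p\<in>proj_plane. (\<lambda>v. A *v v) ` p)"

definition diag3 :: "complex \<Rightarrow> complex \<Rightarrow> complex \<Rightarrow> complex ^ 3 ^ 3" where
  "diag3 x y z = vector [vector [x, 0, 0], vector [0, y, 0], vector [0, 0, z]]"

definition sigma :: "ppoint \<Rightarrow> ppoint" where
  "sigma = proj_map (diag3 (- 1) 1 1)"

definition tau :: "ppoint \<Rightarrow> ppoint" where
  "tau = proj_map (diag3 1 (- 1) 1)"

definition H_group :: "(ppoint \<Rightarrow> ppoint) monoid" where
  "H_group = (BijGroup proj_plane) \<lparr>carrier := generate (BijGroup proj_plane) {sigma, tau}\<rparr>"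

definition H_orbits :: "ppoint set \<Rightarrow> ppoint set set" where
  "H_orbits S = orbits H_group S (\<lambda>h. h)"

text \<open>\<open>forms_orbits S M\<close>: the finite set \<open>S\<close> is a union of \<open>H\<close>-orbits, and \<open>M\<close> lists their sizes,
  each orbit being counted once.\<close>

definition forms_orbits :: "ppoint set \<Rightarrow> nat multiset \<Rightarrow> bool" where
  "forms_orbits S M \<longleftrightarrow>
     finite S \<and> \<Union> (H_orbits S) = S \<and> image_mset card (mset_set (H_orbits S)) = M"

section \<open>The quartic and its flexes\<close>

text \<open>Polymorphic, so that it can be evaluated at complex numbers and at polynomials.\<close>

definition quartic :: "'r::comm_ring_1 \<Rightarrow> 'r \<Rightarrow> 'r \<Rightarrow> 'r \<Rightarrow> 'r \<Rightarrow> 'r \<Rightarrow> 'r" where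
  "quartic a b c x y z =
     x ^ 4 + y ^ 4 + z ^ 4 + a * x ^ 2 * y ^ 2 + b * x ^ 2 * z ^ 2 + c * y ^ 2 * z ^ 2"

definition curve :: "complex \<Rightarrow> complex \<Rightarrow> complex \<Rightarrow> ppoint set" where
  "curve a b c = {p \<in> proj_plane. \<forall>v\<in>p. quartic a b c (v $ 1) (v $ 2) (v $ 3) = 0}"

definition gradient :: "complex \<Rightarrow> complex \<Rightarrow> complex \<Rightarrow> complex ^ 3 \<Rightarrow> complex ^ 3" where
  "gradient a b c v =
     (let x = v $ 1; y = v $ 2; z = v $ 3 in
      vector [4 * x ^ 3 + 2 * a * x * y ^ 2 + 2 * b * x * z ^ 2,
              4 * y ^ 3 + 2 * a * x ^ 2 * y + 2 * c * y * z ^ 2,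
              4 * z ^ 3 + 2 * b * x ^ 2 * z + 2 * c * y ^ 2 * z])"

lemma quartic_has_derivative:
  "((\<lambda>v. quartic a b c (v $ 1) (v $ 2) (v $ 3)) has_derivative
    (\<lambda>h. \<Sum>k\<in>UNIV. gradient a b c v $ k * h $ k)) (at v)"
  unfolding quartic_def gradient_def Let_def
  by (rule has_derivative_eq_rhs)
     (auto intro!: derivative_eq_intros bounded_linear.has_derivative[OF bounded_linear_vec_nth]
       simp: fun_eq_iff sum_3 algebra_simps)

definition tangent_line :: "complex \<Rightarrow> complex \<Rightarrow> complex \<Rightarrow> ppoint \<Rightarrow> (complex ^ 3) set" where
  "tangent_line a b c p = {w. \<forall>v\<in>p. (\<Sum>k\<in>UNIV. gradient a b c v $ k * w $ k) = 0}"

text \<open>The polynomial \<open>F(v + T w)\<close> in \<open>T\<close>, where \<open>F\<close> is the quartic form.\<close>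

definition quartic_along ::
    "complex \<Rightarrow> complex \<Rightarrow> complex \<Rightarrow> complex ^ 3 \<Rightarrow> complex ^ 3 \<Rightarrow> complex poly" where
  "quartic_along a b c v w =
     quartic [:a:] [:b:] [:c:] [:v $ 1, w $ 1:] [:v $ 2, w $ 2:] [:v $ 3, w $ 3:]"

text \<open>The intersection multiplicity at \<open>p\<close> of the curve with a line \<open>L\<close> through \<open>p\<close>: the vanishing
  order of the quartic form at \<open>T = 0\<close> along \<open>v + T w\<close>, which does not depend on the vectors
  \<open>v\<close>, \<open>w\<close> with \<open>v\<close> spanning \<open>p\<close> and \<open>v\<close>, \<open>w\<close> spanning \<open>L\<close>.
  It is meaningful only if \<open>L\<close> is not contained in the curve, which is never the case for a
  smooth quartic.\<close>

definition intersection_mult ::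
    "complex \<Rightarrow> complex \<Rightarrow> complex \<Rightarrow> (complex ^ 3) set \<Rightarrow> ppoint \<Rightarrow> nat" where
  "intersection_mult a b c L p =
     (THE m. \<exists>v w. p = vec.span {v} \<and> L = vec.span {v, w} \<and>
                   m = Polynomial.order 0 (quartic_along a b c v w))"

definition contact_order :: "complex \<Rightarrow> complex \<Rightarrow> complex \<Rightarrow> ppoint \<Rightarrow> nat" where
  "contact_order a b c p = intersection_mult a b c (tangent_line a b c p) p"

text \<open>For a smooth plane quartic the canonical divisors are the line sections, so the
  1-Weierstrass points are the flexes.\<close>

definition weierstrass_points :: "complex \<Rightarrow> complex \<Rightarrow> complex \<Rightarrow> ppoint set" where
  "weierstrass_points a b c = {p \<in> curve a b c. contact_order a b c p \<ge> 3}"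

definition ordinary_flexes :: "complex \<Rightarrow> complex \<Rightarrow> complex \<Rightarrow> ppoint set" where
  "ordinary_flexes a b c = {p \<in> weierstrass_points a b c. contact_order a b c p = 3}"

definition hyperflexes :: "complex \<Rightarrow> complex \<Rightarrow> complex \<Rightarrow> ppoint set" where
  "hyperflexes a b c = {p \<in> weierstrass_points a b c. contact_order a b c p = 4}"

section \<open>Conditions on the parameters\<close>

text \<open>For admissible parameters all three of the expressions below vanish only at \<open>a = b = c = 0\<close>.
  This is the Fermat quartic, whose twelve flexes are hyperflexes on the lines \<open>x y z = 0\<close> and form
  six \<open>H\<close>-orbits of two points each.\<close>

definition admissible :: "complex \<Rightarrow> complex \<Rightarrow> complex \<Rightarrow> bool" where
  "admissible a b c \<longleftrightarrow>
     (a ^ 2 - 1) * (b ^ 2 - 1) * (c ^ 2 - 1) * (a ^ 2 - 4) * (b ^ 2 - 4) * (c ^ 2 - 4) *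
     (a ^ 2 + b ^ 2 + c ^ 2 - a * b * c - 4) \<noteq> 0"

definition P_param :: "nat \<Rightarrow> complex \<Rightarrow> complex \<Rightarrow> complex \<Rightarrow> complex" where
  "P_param i a b c =
     (if i = 1 then a ^ 2 + b ^ 2 - a * b * c
      else if i = 2 then a ^ 2 + c ^ 2 - a * b * c
      else b ^ 2 + c ^ 2 - a * b * c)"

end

theory Submission
  imports Defs
begin

text \<open>
  Put \<open>X = x\<^sup>2\<close>, \<open>Y = y\<^sup>2\<close>, \<open>Z = z\<^sup>2\<close>.  The quartic is the preimage of the conic
  \<open>Q = X\<^sup>2 + Y\<^sup>2 + Z\<^sup>2 + a X Y + b X Z + c Y Z\<close> under the squaring map, and the fibres of the squaring map
  are exactly the \<open>H\<close>-orbits: four points over a point with \<open>X Y Z \<noteq> 0\<close>, two over a point with one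
  vanishing coordinate.  So the number of orbits of each size is the number of points of the conic of
  each kind, and only the contact order has to be expressed in \<open>X\<close>, \<open>Y\<close>, \<open>Z\<close>.

  If \<open>x y z \<noteq> 0\<close>, the direction \<open>(x Y Q\<^sub>Y, - y X Q\<^sub>X, 0)\<close> lies on the tangent line at \<open>(x, y, z)\<close>.
  Expanding the quartic along it shows that the point is a flex iff
  \<open>Q\<^sub>X Q\<^sub>Y Q\<^sub>Z + 4 D X Y Z = 0\<close> with \<open>D = 4 - a\<^sup>2 - b\<^sup>2 - c\<^sup>2 + a b c\<close>, and the coefficient of \<open>T\<^sup>3\<close> tells
  the hyperflexes apart (\<open>contact_order_interior\<close>).  At a point with a vanishing coordinate the
  tangent line passes through the opposite vertex of the coordinate triangle, the cubic
  coefficient is zero and the quartic one is \<open>1\<close>, so that the contact order is \<open>2\<close> or \<open>4\<close>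
  (\<open>contact_order_on_axis\<close>).

  Permuting the coordinates and replacing \<open>y\<close> by \<open>\<i> y\<close> permutes the curves of the family and
  normalises \<open>H\<close> (\<open>flex_configuration_transport\<close>), so one may assume \<open>P\<^sub>1 = P\<^sub>2 = 0\<close> and \<open>c = b\<close>.
  Then \<open>b\<^sup>2 (a - 1) = a\<^sup>2\<close>; with \<open>k = b / a\<close> and \<open>X = k s\<close>, \<open>Y = k t\<close>, \<open>Z = 1\<close> all equations have
  coefficients in \<open>\<rat>(a)\<close>.  They are symmetric in \<open>s\<close> and \<open>t\<close>, hence equations for \<open>u = s + t\<close>, the product
  \<open>s t\<close> being determined by \<open>u\<close> through the conic.  The flex equation becomes \<open>(u + 1) q(u) = 0\<close>, where
  \<open>u = - 1\<close> gives the two orbits of hyperflexes on \<open>x = 0\<close> and \<open>y = 0\<close>, and \<open>q\<close> is quadratic with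
  discriminant \<open>- 3 (a + 2) (5 a - 6) (a - 2)\<^sup>2\<close>.  Each root \<open>u\<close> gives the two points \<open>(s, t)\<close>, \<open>(t, s)\<close>, which
  may coincide.  The hyperflex equation is \<open>(t - s) n(u) = 0\<close>, and \<open>n\<close> shares a root with \<open>q\<close> only if
  \<open>5 a = 6\<close>, that is, if \<open>q\<close> has a double root (\<open>normalised_flexes_count\<close>).  Therefore hyperflexes with
  \<open>x y z \<noteq> 0\<close> come from coincidences alone:
  \<^item> \<open>q\<close> has two roots and \<open>s \<noteq> t\<close> for both: four orbits of ordinary flexes;
  \<^item> \<open>q\<close> has two roots and \<open>s = t\<close> for one of them (it cannot happen for both): two orbits of ordinary
    flexes and one orbit of hyperflexes;
  \<^item> \<open>q\<close> has a double root: two orbits of hyperflexes.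
\<close>

section \<open>The group action and the squaring map\<close>

lemma diag3_mult: "diag3 x y z *v v = vector [x * v $ 1, y * v $ 2, z * v $ 3]"
  by (simp add: diag3_def matrix_vector_mult_def vec_eq_iff forall_3 sum_3)

lemma smult_vector3: "k *s (vector [x, y, z] :: complex ^ 3) = vector [k * x, k * y, k * z]"
  by (simp add: vec_eq_iff forall_3)

lemma span_image_mult: "(\<lambda>v. A *v v) ` vec.span {v} = vec.span {A *v v}"
  for A :: "complex ^ 3 ^ 3"
proof -
  have "Vector_Spaces.linear (*s) (*s) ((*v) A)" by simp
  from vec.linear_span_image[OF this, of "{v}"] show ?thesis by simp
qed

lemma span_eq_iff:
  fixes v w :: "complex ^ 3"
  assumes "v \<noteq> 0"
  shows "vec.span {v} = vec.span {w} \<longleftrightarrow> (\<exists>k. k \<noteq> 0 \<and> w = k *s v)"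
proof
  assume "vec.span {v} = vec.span {w}"
  hence "v \<in> vec.span {w}" "w \<in> vec.span {v}" by (metis vec.span_base singletonI)+
  then obtain k l where k: "w = k *s v" "v = l *s w"
    by (auto simp: vec.span_singleton)
  hence "k \<noteq> 0" using assms by auto
  thus "\<exists>k. k \<noteq> 0 \<and> w = k *s v" using k by auto
next
  assume "\<exists>k. k \<noteq> 0 \<and> w = k *s v"
  then obtain k where k: "k \<noteq> 0" "w = k *s v" by auto
  have *: "l *s v = (l / k) *s w" for l using k by (simp add: vector_smult_assoc)
  have "vec.span {v} \<subseteq> vec.span {w}"
    unfolding vec.span_singleton using * by auto
  moreover have "vec.span {w} \<subseteq> vec.span {v}"
    unfolding vec.span_singleton using k by (auto simp: vector_smult_assoc)
  ultimately show "vec.span {v} = vec.span {w}" by blast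
qed

definition chart :: "complex \<Rightarrow> complex \<Rightarrow> ppoint" where
  "chart x y = vec.span {vector [x, y, 1]}"

text \<open>The fibre of the squaring map over the point with affine coordinates \<open>q\<close>.\<close>

definition sq_fibre :: "complex \<times> complex \<Rightarrow> ppoint set" where
  "sq_fibre q = {chart x y | x y. (x ^ 2, y ^ 2) = q}"

lemma vector3_nonzero: "z \<noteq> 0 \<Longrightarrow> (vector [x, y, z] :: complex ^ 3) \<noteq> 0"
  by (auto simp: vec_eq_iff forall_3)

lemma chart_in_plane: "chart x y \<in> proj_plane"
  unfolding proj_plane_def chart_def using vector3_nonzero[of 1 x y] by auto

lemma chart_eq_iff: "chart x y = chart x' y' \<longleftrightarrow> x = x' \<and> y = y'"
  unfolding chart_def span_eq_iff[OF vector3_nonzero[OF one_neq_zero]]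
  by (auto simp: vec_eq_iff forall_3)

text \<open>With all three signs allowed to vary, compatibility with permutations of the coordinates is
  visible; up to a common sign the eight patterns are the four elements of \<open>H\<close>.\<close>

definition sign_orbit :: "ppoint \<Rightarrow> ppoint set" where
  "sign_orbit p = {(\<lambda>v. diag3 e f g *v v) ` p | e f g. {e, f, g} \<subseteq> {1, - 1}}"

lemma diag3_image_in_plane:
  assumes "p \<in> proj_plane" "x \<noteq> 0" "y \<noteq> 0" "z \<noteq> 0"
  shows "(\<lambda>v. diag3 x y z *v v) ` p \<in> proj_plane"
proof -
  obtain v where v: "p = vec.span {v}" "v \<noteq> 0" using assms(1) by (auto simp: proj_plane_def)
  have "diag3 x y z *v v \<noteq> 0" using v(2) assms(2-)
    by (auto simp: diag3_mult vec_eq_iff forall_3)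
  thus ?thesis unfolding v(1) span_image_mult proj_plane_def by auto
qed

lemma diag3_diag3: "diag3 x y z *v (diag3 x' y' z' *v v) = diag3 (x * x') (y * y') (z * z') *v v"
  by (simp add: diag3_mult mult.assoc)

lemma diag3_one: "diag3 1 1 1 *v v = v"
  by (simp add: diag3_mult vec_eq_iff forall_3)

lemma proj_map_diag3_Bij:
  assumes "{x, y, z} \<subseteq> {1, - 1}"
  shows "proj_map (diag3 x y z) \<in> Bij proj_plane"
proof -
  have nz: "x \<noteq> 0" "y \<noteq> 0" "z \<noteq> 0" "x * x = 1" "y * y = 1" "z * z = 1" using assms by auto
  have "bij_betw (proj_map (diag3 x y z)) proj_plane proj_plane"
    by (rule bij_betwI[where g = "proj_map (diag3 x y z)"])
       (auto simp: proj_map_def nz diag3_image_in_plane image_image diag3_diag3 diag3_one)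
  thus ?thesis by (simp add: Bij_def proj_map_def)
qed

lemma proj_map_diag3_mult:
  assumes "{x, y, z, x', y', z'} \<subseteq> {1, - 1}"
  shows "proj_map (diag3 x y z) \<otimes>\<^bsub>BijGroup proj_plane\<^esub> proj_map (diag3 x' y' z') =
         proj_map (diag3 (x * x') (y * y') (z * z'))"
proof -
  have nz: "x' \<noteq> 0" "y' \<noteq> 0" "z' \<noteq> 0" using assms by auto
  have B: "proj_map (diag3 x y z) \<in> Bij proj_plane" "proj_map (diag3 x' y' z') \<in> Bij proj_plane"
    using assms by (intro proj_map_diag3_Bij; simp)+
  show ?thesis
    unfolding BijGroup_def using B
    by (auto simp: compose_def proj_map_def fun_eq_iff restrict_def image_image diag3_diag3
          diag3_image_in_plane[OF _ nz])
qed

lemma one_BijGroup_plane: "\<one>\<^bsub>BijGroup proj_plane\<^esub> = proj_map (diag3 1 1 1)"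
  by (auto simp: BijGroup_def proj_map_def diag3_one fun_eq_iff)

text \<open>The four maps with signs on the first two coordinates are closed under composition and are their
  own inverses, so they already form the group generated by \<open>\<sigma>\<close> and \<open>\<tau>\<close>.\<close>

lemma H_group_carrier:
  "carrier H_group = {proj_map (diag3 e f 1) | e f. {e, f} \<subseteq> {1, - 1}}"
proof -
  interpret G: group "BijGroup proj_plane" by (rule group_BijGroup)
  define K where "K = {proj_map (diag3 e f 1) | e f. {e, f} \<subseteq> {1, - 1}}"
  have K_I: "proj_map (diag3 e f 1) \<in> K" if "{e, f} \<subseteq> {1, - 1}" for e f
    unfolding K_def using that by blast
  have K_E: "\<exists>e f. h = proj_map (diag3 e f 1) \<and> {e, f} \<subseteq> {1, - 1}" if "h \<in> K" for h
    using that unfolding K_def by blast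
  have st: "{sigma, tau} \<subseteq> K"
    using K_I[of "- 1" 1] K_I[of 1 "- 1"] unfolding sigma_def tau_def by simp
  have mem: "proj_map (diag3 e f 1) \<in> carrier (BijGroup proj_plane)" if "{e, f} \<subseteq> {1, - 1}" for e f
    using proj_map_diag3_Bij[of e f 1] that by (simp add: BijGroup_def)
  have inv: "inv\<^bsub>BijGroup proj_plane\<^esub> (proj_map (diag3 e f 1)) = proj_map (diag3 e f 1)"
    if "{e, f} \<subseteq> {1, - 1}" for e f
  proof (rule G.inv_equality)
    have "e * e = 1" "f * f = 1" "{e, f, 1, e, f, 1} \<subseteq> {1, - 1}" using that by auto
    thus "proj_map (diag3 e f 1) \<otimes>\<^bsub>BijGroup proj_plane\<^esub> proj_map (diag3 e f 1) = \<one>\<^bsub>BijGroup proj_plane\<^esub>"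
      unfolding one_BijGroup_plane using proj_map_diag3_mult[of e f 1 e f 1] by (simp only: mult_1)
  qed (use that in \<open>rule mem\<close>)+
  have "subgroup K (BijGroup proj_plane)"
  proof (rule G.subgroupI)
    show "K \<subseteq> carrier (BijGroup proj_plane)"
    proof
      fix h assume "h \<in> K"
      from K_E[OF this] obtain e f where *: "h = proj_map (diag3 e f 1)" "{e, f} \<subseteq> {1, - 1}" by blast
      show "h \<in> carrier (BijGroup proj_plane)" unfolding *(1) using *(2) by (rule mem)
    qed
    have "sigma \<in> K" using st by simp
    thus "K \<noteq> {}" by blast
  next
    fix h assume "h \<in> K"
    from K_E[OF this] obtain e f where *: "h = proj_map (diag3 e f 1)" "{e, f} \<subseteq> {1, - 1}" by blast
    show "inv\<^bsub>BijGroup proj_plane\<^esub> h \<in> K" unfolding *(1) inv[OF *(2)] by (rule K_I[OF *(2)])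
  next
    fix h h' assume h: "h \<in> K" "h' \<in> K"
    obtain e f where *: "h = proj_map (diag3 e f 1)" "{e, f} \<subseteq> {1, - 1}" using K_E[OF h(1)] by blast
    obtain e' f' where **: "h' = proj_map (diag3 e' f' 1)" "{e', f'} \<subseteq> {1, - 1}" using K_E[OF h(2)] by blast
    have "h \<otimes>\<^bsub>BijGroup proj_plane\<^esub> h' = proj_map (diag3 (e * e') (f * f') 1)"
      unfolding *(1) **(1) using proj_map_diag3_mult[of e f 1 e' f' 1] *(2) **(2) by simp
    moreover have "{e * e', f * f'} \<subseteq> {1, - 1}" using *(2) **(2) by auto
    ultimately show "h \<otimes>\<^bsub>BijGroup proj_plane\<^esub> h' \<in> K" using K_I[of "e * e'" "f * f'"] by simp
  qed
  hence "generate (BijGroup proj_plane) {sigma, tau} \<subseteq> K"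
    using st by (intro G.generate_subgroup_incl)
  moreover have "h \<in> generate (BijGroup proj_plane) {sigma, tau}" (is "_ \<in> ?gen") if h: "h \<in> K" for h
  proof -
    have g: "proj_map (diag3 (- 1) 1 1) \<in> ?gen" "proj_map (diag3 1 (- 1) 1) \<in> ?gen"
      unfolding sigma_def tau_def by (rule generate.incl, simp)+
    have "proj_map (diag3 1 1 1) \<in> ?gen"
      unfolding one_BijGroup_plane[symmetric] by (rule generate.one)
    moreover have "proj_map (diag3 (- 1) (- 1) 1) \<in> ?gen"
      using generate.eng[OF g] proj_map_diag3_mult[of "- 1" 1 1 1 "- 1" 1] by simp
    moreover obtain e f where *: "h = proj_map (diag3 e f 1)" "{e, f} \<subseteq> {1, - 1}"
      using K_E[OF h] by blast
    ultimately show ?thesis using g by auto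
  qed
  ultimately have "generate (BijGroup proj_plane) {sigma, tau} = K" by blast
  thus ?thesis unfolding K_def by (simp add: H_group_def)
qed

lemma H_orbit_eq: "orbit H_group (\<lambda>h. h) p = {proj_map (diag3 e f 1) p | e f. {e, f} \<subseteq> {1, - 1}}"
proof -
  have "{g p | g. g \<in> {P e f | e f. R e f}} = {P e f p | e f. R e f}"
    for P :: "complex \<Rightarrow> complex \<Rightarrow> ppoint \<Rightarrow> ppoint" and R by auto
  thus ?thesis unfolding orbit_def H_group_carrier .
qed

lemma minus_diag3_image:
  assumes "p \<in> proj_plane"
  shows "(\<lambda>v. diag3 (- x) (- y) (- z) *v v) ` p = (\<lambda>v. diag3 x y z *v v) ` p"
proof -
  obtain v where v: "p = vec.span {v}" using assms by (auto simp: proj_plane_def)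
  have "diag3 (- x) (- y) (- z) *v v = - (diag3 x y z *v v)"
    by (simp add: diag3_mult vec_eq_iff forall_3)
  moreover have "vec.span {- w} = vec.span {w}" for w :: "complex ^ 3"
    using span_eq_iff[of w "- w"] by (cases "w = 0") (auto intro!: exI[of _ "-1"])
  ultimately show ?thesis unfolding v span_image_mult by simp
qed

text \<open>Scaling by the third sign makes it \<open>1\<close>.\<close>

lemma H_orbit_eq_sign_orbit:
  assumes "p \<in> proj_plane"
  shows "orbit H_group (\<lambda>h. h) p = sign_orbit p"
proof
  show "orbit H_group (\<lambda>h. h) p \<subseteq> sign_orbit p"
  proof
    fix q assume "q \<in> orbit H_group (\<lambda>h. h) p"
    then obtain e f where "q = proj_map (diag3 e f 1) p" "{e, f} \<subseteq> {1, - 1}"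
      unfolding H_orbit_eq by blast
    hence "q = (\<lambda>v. diag3 e f 1 *v v) ` p" "{e, f, 1} \<subseteq> {1, - 1}"
      using assms by (simp_all add: proj_map_def)
    thus "q \<in> sign_orbit p" unfolding sign_orbit_def by blast
  qed
  show "sign_orbit p \<subseteq> orbit H_group (\<lambda>h. h) p"
  proof
    fix q assume "q \<in> sign_orbit p"
    then obtain e f g where q: "q = (\<lambda>v. diag3 e f g *v v) ` p" "{e, f, g} \<subseteq> {1, - 1}"
      unfolding sign_orbit_def by blast
    have "q = (\<lambda>v. diag3 (e * g) (f * g) 1 *v v) ` p"
      using q minus_diag3_image[OF assms, of e f g] by auto
    hence "q = proj_map (diag3 (e * g) (f * g) 1) p" using assms by (simp add: proj_map_def)
    moreover have "{e * g, f * g} \<subseteq> {1, - 1}" using q by auto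
    ultimately show "q \<in> orbit H_group (\<lambda>h. h) p"
      unfolding H_orbit_eq by blast
  qed
qed

lemma sign_orbit_chart: "sign_orbit (chart x y) = sq_fibre (x ^ 2, y ^ 2)"
proof -
  have "proj_map (diag3 e f 1) (chart x y) = chart (e * x) (f * y)" for e f
    using chart_in_plane[of x y]
    by (simp only: proj_map_def chart_def span_image_mult restrict_apply') (simp add: diag3_mult)
  hence "sign_orbit (chart x y) = {chart (e * x) (f * y) | e f. {e, f} \<subseteq> {1, - 1}}"
    by (simp only: H_orbit_eq_sign_orbit[OF chart_in_plane, symmetric] H_orbit_eq)
  also have "\<dots> = sq_fibre (x ^ 2, y ^ 2)"
  proof
    show "{chart (e * x) (f * y) | e f. {e, f} \<subseteq> {1, - 1}} \<subseteq> sq_fibre (x ^ 2, y ^ 2)"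
      unfolding sq_fibre_def by fastforce
    show "sq_fibre (x ^ 2, y ^ 2) \<subseteq> {chart (e * x) (f * y) | e f. {e, f} \<subseteq> {1, - 1}}"
    proof
      fix q assume "q \<in> sq_fibre (x ^ 2, y ^ 2)"
      then obtain x' y' where q: "q = chart x' y'" "x' ^ 2 = x ^ 2" "y' ^ 2 = y ^ 2"
        unfolding sq_fibre_def by auto
      obtain e f where "x' = e * x" "y' = f * y" "{e, f} \<subseteq> {1, - 1}"
      proof (rule that)
        show "x' = (if x' = x then 1 else - 1) * x" "y' = (if y' = y then 1 else - 1) * y"
          using q(2,3) by (auto simp: power2_eq_iff)
      qed auto
      thus "q \<in> {chart (e * x) (f * y) | e f. {e, f} \<subseteq> {1, - 1}}" using q(1) by blast
    qed
  qed
  finally show ?thesis .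
qed

lemma H_orbits_eq:
  assumes "S \<subseteq> proj_plane"
  shows "H_orbits S = sign_orbit ` S"
proof -
  have "H_orbits S = orbit H_group (\<lambda>h. h) ` S"
    unfolding H_orbits_def orbits_def by blast
  also have "\<dots> = sign_orbit ` S"
    using assms by (intro image_cong refl H_orbit_eq_sign_orbit) blast
  finally show ?thesis .
qed

lemma sq_fibre_nonempty: "sq_fibre q \<noteq> {}"
proof -
  have "chart (csqrt (fst q)) (csqrt (snd q)) \<in> sq_fibre q"
    unfolding sq_fibre_def
    by (intro CollectI exI[of _ "csqrt (fst q)"] exI[of _ "csqrt (snd q)"]) simp
  thus ?thesis by blast
qed

lemma sq_fibre_disjoint: "q \<noteq> q' \<Longrightarrow> sq_fibre q \<inter> sq_fibre q' = {}"
  unfolding sq_fibre_def by (auto simp: chart_eq_iff)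

lemma sq_fibre_eq_image:
  "sq_fibre (x ^ 2, y ^ 2) = (\<lambda>(u, v). chart u v) ` ({x, - x} \<times> {y, - y})"
  unfolding sq_fibre_def by (auto simp: power2_eq_iff image_iff)

lemma card_sq_fibre:
  assumes "q \<noteq> (0, 0)"
  shows "finite (sq_fibre q)" "card (sq_fibre q) = (if fst q = 0 \<or> snd q = 0 then 2 else 4)"
proof -
  obtain x y where q: "q = (x ^ 2, y ^ 2)"
    by (metis power2_csqrt prod.collapse)
  have inj: "inj_on (\<lambda>(u, v). chart u v) ({x, - x} \<times> {y, - y})"
    by (auto simp: inj_on_def chart_eq_iff)
  have neg: "x = - x \<longleftrightarrow> x = 0" for x :: complex
    by (metis add.inverse_neutral add_eq_0_iff2 mult_2 mult_eq_0_iff zero_neq_numeral)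
  show "finite (sq_fibre q)" unfolding q sq_fibre_eq_image by simp
  have "card {x, - x} = (if x = 0 then 1 else 2)" for x :: complex
    using neg[of x] by simp
  thus "card (sq_fibre q) = (if fst q = 0 \<or> snd q = 0 then 2 else 4)"
    unfolding q sq_fibre_eq_image card_image[OF inj] card_cartesian_product
    using assms q by auto
qed

text \<open>Distinct fibres are disjoint and each is one orbit, so the orbit structure of a union of fibres is
  read off from the base points.  Over \<open>(0, 0)\<close> the fibre would be a single point; that point does not lie
  on any of the curves.\<close>

lemma forms_orbits_sq_fibres:
  assumes N: "finite N" "(0, 0) \<notin> N"
  shows "forms_orbits (\<Union> (sq_fibre ` N))
           (image_mset (\<lambda>q. if fst q = 0 \<or> snd q = 0 then 2 else 4) (mset_set N))"
    and "card (\<Union> (sq_fibre ` N)) = (\<Sum>q\<in>N. if fst q = 0 \<or> snd q = 0 then 2 else 4)"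
proof -
  have nz: "q \<noteq> (0, 0)" if "q \<in> N" for q using N that by auto
  have orb: "H_orbits (\<Union> (sq_fibre ` N)) = sq_fibre ` N"
  proof -
    have single: "sign_orbit ` sq_fibre q = {sq_fibre q}" for q
    proof -
      have "sign_orbit p = sq_fibre q" if p: "p \<in> sq_fibre q" for p
      proof -
        obtain x y where "p = chart x y" "(x ^ 2, y ^ 2) = q"
          using p unfolding sq_fibre_def by blast
        thus ?thesis using sign_orbit_chart[of x y] by simp
      qed
      thus ?thesis using sq_fibre_nonempty[of q] by auto
    qed
    have "\<Union> (sq_fibre ` N) \<subseteq> proj_plane"
      unfolding sq_fibre_def using chart_in_plane by auto
    thus ?thesis by (simp add: H_orbits_eq image_UN single UNION_singleton_eq_range)
  qed
  have inj: "inj_on sq_fibre N"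
    by (rule inj_onI) (metis sq_fibre_disjoint sq_fibre_nonempty inf.idem)
  have "image_mset card (mset_set (sq_fibre ` N)) = image_mset (card \<circ> sq_fibre) (mset_set N)"
    by (simp add: image_mset_mset_set[OF inj, symmetric] multiset.map_comp)
  also have "\<dots> = image_mset (\<lambda>q. if fst q = 0 \<or> snd q = 0 then 2 else 4) (mset_set N)"
    by (rule image_mset_cong) (use N nz card_sq_fibre(2) in auto)
  finally show "forms_orbits (\<Union> (sq_fibre ` N))
           (image_mset (\<lambda>q. if fst q = 0 \<or> snd q = 0 then 2 else 4) (mset_set N))"
    unfolding forms_orbits_def orb using N nz card_sq_fibre(1) by auto
  have "card (\<Union> (sq_fibre ` N)) = (\<Sum>q\<in>N. card (sq_fibre q))"
    by (rule card_UN_disjoint) (use N nz card_sq_fibre(1) sq_fibre_disjoint in auto)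
  thus "card (\<Union> (sq_fibre ` N)) = (\<Sum>q\<in>N. if fst q = 0 \<or> snd q = 0 then 2 else 4)"
    using nz card_sq_fibre(2) by simp
qed

text \<open>Matrices rather than maps on points: a linear change of coordinates normalises \<open>H\<close> as soon as its
  matrix normalises this set.\<close>

definition sign_matrices :: "(complex ^ 3 ^ 3) set" where
  "sign_matrices = {diag3 e f g | e f g. {e, f, g} \<subseteq> {1, - 1}}"

lemma sign_orbit_matrices: "sign_orbit p = (\<lambda>D. (*v) D ` p) ` sign_matrices"
  unfolding sign_orbit_def sign_matrices_def by blast

lemma sign_orbit_image:
  assumes "(\<lambda>D. A ** D) ` sign_matrices = (\<lambda>D. D ** A) ` sign_matrices"
  shows "sign_orbit ((*v) A ` p) = (`) ((*v) A) ` sign_orbit p"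
proof -
  have "sign_orbit ((*v) A ` p) = (\<lambda>D. (*v) D ` p) ` (\<lambda>D. D ** A) ` sign_matrices"
    unfolding sign_orbit_matrices image_image by (simp add: matrix_vector_mul_assoc)
  also have "\<dots> = (\<lambda>D. (*v) D ` p) ` (\<lambda>D. A ** D) ` sign_matrices"
    using assms by simp
  also have "\<dots> = (`) ((*v) A) ` sign_orbit p"
    unfolding sign_orbit_matrices image_image by (simp add: matrix_vector_mul_assoc)
  finally show ?thesis .
qed

lemma proj_plane_image:
  fixes A :: "complex ^ 3 ^ 3"
  assumes "inj ((*v) A)" "p \<in> proj_plane"
  shows "(*v) A ` p \<in> proj_plane"
proof -
  obtain v where v: "p = vec.span {v}" "v \<noteq> 0" using assms(2) by (auto simp: proj_plane_def)
  have "A *v v \<noteq> 0" using inj_eq[OF assms(1), of v 0] v(2) by simp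
  thus ?thesis unfolding v(1) span_image_mult proj_plane_def by auto
qed

text \<open>The induced map on points is injective and commutes with forming orbits, so it preserves the number
  and the sizes of the orbits.\<close>

lemma forms_orbits_image:
  fixes A :: "complex ^ 3 ^ 3"
  assumes A: "inj ((*v) A)" "(\<lambda>D. A ** D) ` sign_matrices = (\<lambda>D. D ** A) ` sign_matrices"
    and S: "S \<subseteq> proj_plane" "forms_orbits S M"
  shows "forms_orbits ((`) ((*v) A) ` S) M"
proof -
  define G where "G = (`) ((*v) A)"
  have inj: "inj G" unfolding G_def using A(1) by (rule inj_image_eq_iff[THEN iffD1, THEN injI])
  have "G ` S \<subseteq> proj_plane" unfolding G_def using S(1) proj_plane_image[OF A(1)] by auto
  hence orb: "H_orbits (G ` S) = (`) G ` H_orbits S"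
    using S(1) sign_orbit_image[OF A(2)] by (simp add: H_orbits_eq image_image G_def)
  have inj': "inj_on ((`) G) X" for X
    using inj by (auto simp: inj_on_def inj_image_eq_iff)
  have "image_mset card (mset_set ((`) G ` H_orbits S)) = image_mset (card \<circ> (`) G) (mset_set (H_orbits S))"
    by (simp add: image_mset_mset_set[OF inj', symmetric] multiset.map_comp)
  also have "\<dots> = image_mset card (mset_set (H_orbits S))"
    by (rule image_mset_cong) (simp add: card_image[OF inj_on_subset[OF inj]])
  finally show ?thesis
    using S(2) unfolding forms_orbits_def G_def[symmetric] orb by (auto simp: image_Union[symmetric])
qed

section \<open>Contact order along an arbitrary tangent direction\<close>

abbreviation form :: "complex \<Rightarrow> complex \<Rightarrow> complex \<Rightarrow> complex ^ 3 \<Rightarrow> complex" where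
  "form a b c v \<equiv> quartic a b c (v $ 1) (v $ 2) (v $ 3)"

text \<open>Polars of the quartic form: \<open>polar\<close> and \<open>polar2\<close> are the coefficients of \<open>T\<close> and \<open>T\<^sup>2\<close> in
  \<open>F(v + T w)\<close>; by symmetry the coefficient of \<open>T\<^sup>3\<close> is \<open>polar\<close> with the arguments exchanged.\<close>

definition polar :: "complex \<Rightarrow> complex \<Rightarrow> complex \<Rightarrow> complex ^ 3 \<Rightarrow> complex ^ 3 \<Rightarrow> complex" where
  "polar a b c v w = (\<Sum>k\<in>UNIV. gradient a b c v $ k * w $ k)"

definition polar2 :: "complex \<Rightarrow> complex \<Rightarrow> complex \<Rightarrow> complex ^ 3 \<Rightarrow> complex ^ 3 \<Rightarrow> complex" where
  "polar2 a b c v w =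
     6 * (v $ 1 * w $ 1) ^ 2 + 6 * (v $ 2 * w $ 2) ^ 2 + 6 * (v $ 3 * w $ 3) ^ 2 +
     a * ((v $ 1 * w $ 2) ^ 2 + 4 * v $ 1 * v $ 2 * w $ 1 * w $ 2 + (v $ 2 * w $ 1) ^ 2) +
     b * ((v $ 1 * w $ 3) ^ 2 + 4 * v $ 1 * v $ 3 * w $ 1 * w $ 3 + (v $ 3 * w $ 1) ^ 2) +
     c * ((v $ 2 * w $ 3) ^ 2 + 4 * v $ 2 * v $ 3 * w $ 2 * w $ 3 + (v $ 3 * w $ 2) ^ 2)"

lemma polar_alt:
  "polar a b c v w =
     (4 * v $ 1 ^ 3 + 2 * a * v $ 1 * v $ 2 ^ 2 + 2 * b * v $ 1 * v $ 3 ^ 2) * w $ 1 +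
     (4 * v $ 2 ^ 3 + 2 * a * v $ 1 ^ 2 * v $ 2 + 2 * c * v $ 2 * v $ 3 ^ 2) * w $ 2 +
     (4 * v $ 3 ^ 3 + 2 * b * v $ 1 ^ 2 * v $ 3 + 2 * c * v $ 2 ^ 2 * v $ 3) * w $ 3"
  by (simp add: polar_def gradient_def Let_def sum_3)

lemma linear_poly_power2: "[:x, y:] ^ 2 = [:x ^ 2, 2 * x * y, y ^ 2:]" for x y :: complex
  by (simp add: power2_eq_square)

lemma linear_poly_power4:
  "[:x, y:] ^ 4 = [:x ^ 4, 4 * x ^ 3 * y, 6 * x ^ 2 * y ^ 2, 4 * x * y ^ 3, y ^ 4:]" for x y :: complex
proof -
  have "[:x, y:] ^ 4 = ([:x, y:] ^ 2) ^ 2" by simp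
  thus ?thesis unfolding linear_poly_power2 by (simp add: power2_eq_square power3_eq_cube power4_eq_xxxx)
qed

lemma quartic_along_eq:
  "quartic_along a b c v w =
     [:form a b c v, polar a b c v w, polar2 a b c v w, polar a b c w v, form a b c w:]"
  unfolding quartic_along_def quartic_def linear_poly_power2 linear_poly_power4 polar_alt polar2_def
  by (simp add: power2_eq_square algebra_simps)

text \<open>How the five coefficients of \<open>F(v + T w)\<close> change when \<open>v\<close> and \<open>w\<close> are replaced by another basis of the
  same line whose first vector spans the same point.  The change is triangular.\<close>

lemma expand_along_line:
  "form a b c (l *s v) = l ^ 4 * form a b c v"
  "polar a b c (l *s v) (m *s v + n *s w) = l ^ 3 * (4 * m * form a b c v + n * polar a b c v w)"
  "polar2 a b c (l *s v) (m *s v + n *s w) =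
     l ^ 2 * (6 * m ^ 2 * form a b c v + 3 * m * n * polar a b c v w + n ^ 2 * polar2 a b c v w)"
  "polar a b c (m *s v + n *s w) (l *s v) =
     l * (4 * m ^ 3 * form a b c v + 3 * m ^ 2 * n * polar a b c v w + 2 * m * n ^ 2 * polar2 a b c v w +
          n ^ 3 * polar a b c w v)"
  "form a b c (m *s v + n *s w) =
     m ^ 4 * form a b c v + m ^ 3 * n * polar a b c v w + m ^ 2 * n ^ 2 * polar2 a b c v w +
     m * n ^ 3 * polar a b c w v + n ^ 4 * form a b c w"
  unfolding polar_alt polar2_def quartic_def vector_add_component vector_smult_component
  by algebra+

lemma order_at_0:
  fixes A B C :: complex
  shows "A \<noteq> 0 \<Longrightarrow> Polynomial.order 0 [:0, 0, A, B, C:] = 2"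
    and "B \<noteq> 0 \<Longrightarrow> Polynomial.order 0 [:0, 0, 0, B, C:] = 3"
    and "C \<noteq> 0 \<Longrightarrow> Polynomial.order 0 [:0, 0, 0, 0, C:] = 4"
proof -
  have *: "Polynomial.order 0 (monom 1 n * p) = n" if "poly p 0 \<noteq> 0" for n and p :: "complex poly"
  proof -
    have "p \<noteq> 0" using that by auto
    hence "monom 1 n * p \<noteq> 0" by (simp add: monom_eq_0_iff)
    thus ?thesis using order_0I[OF that] by (simp add: order_mult)
  qed
  show "A \<noteq> 0 \<Longrightarrow> Polynomial.order 0 [:0, 0, A, B, C:] = 2"
    using *[of "[:A, B, C:]" 2] by (simp add: numeral_2_eq_2 monom_Suc)
  show "B \<noteq> 0 \<Longrightarrow> Polynomial.order 0 [:0, 0, 0, B, C:] = 3"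
    using *[of "[:B, C:]" 3] by (simp add: numeral_3_eq_3 monom_Suc)
  show "C \<noteq> 0 \<Longrightarrow> Polynomial.order 0 [:0, 0, 0, 0, C:] = 4"
    using *[of "[:C:]" 4] by (simp add: eval_nat_numeral monom_Suc)
qed

text \<open>Because the change of coefficients is triangular with nonzero diagonal entries, the first
  nonvanishing coefficient stays in place.\<close>

lemma order_along_same_line:
  assumes "form a b c v = 0" "polar a b c v w = 0" "l \<noteq> 0" "n \<noteq> 0"
  shows "Polynomial.order 0 (quartic_along a b c (l *s v) (m *s v + n *s w)) =
         Polynomial.order 0 (quartic_along a b c v w)"
proof -
  define C D E where "C = polar2 a b c v w" and "D = polar a b c w v" and "E = form a b c w"
  have 1: "quartic_along a b c v w = [:0, 0, C, D, E:]"
    unfolding quartic_along_eq assms C_def D_def E_def ..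
  have 2: "quartic_along a b c (l *s v) (m *s v + n *s w) =
     [:0, 0, l ^ 2 * n ^ 2 * C, l * (2 * m * n ^ 2 * C + n ^ 3 * D),
       m ^ 2 * n ^ 2 * C + m * n ^ 3 * D + n ^ 4 * E:]"
    unfolding quartic_along_eq expand_along_line assms C_def D_def E_def by simp
  consider "C \<noteq> 0" | "C = 0" "D \<noteq> 0" | "C = 0" "D = 0" "E \<noteq> 0" | "C = 0" "D = 0" "E = 0" by blast
  thus ?thesis
    unfolding 1 2 using assms(3,4) by cases (simp_all add: order_at_0)
qed

lemma tangent_line_span:
  assumes "v \<noteq> 0"
  shows "tangent_line a b c (vec.span {v}) = {w. polar a b c v w = 0}"
proof -
  have "polar a b c (l *s v) w = l ^ 3 * polar a b c v w" for l w
    unfolding polar_alt vector_smult_component by algebra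
  moreover have "v \<in> vec.span {v}" by (simp add: vec.span_base)
  ultimately show ?thesis
    unfolding tangent_line_def polar_def[symmetric] by (auto simp: vec.span_singleton)
qed

text \<open>The kernel of a nonzero linear form on \<open>\<complex>\<^sup>3\<close> is two-dimensional: a third independent vector in it
  would force the form to vanish.\<close>

lemma kernel_eq_span:
  fixes g v w :: "complex ^ 3"
  assumes "g \<noteq> 0" "v \<noteq> 0" "w \<notin> vec.span {v}"
    and "(\<Sum>k\<in>UNIV. g $ k * v $ k) = 0" "(\<Sum>k\<in>UNIV. g $ k * w $ k) = 0"
  shows "{u. (\<Sum>k\<in>UNIV. g $ k * u $ k) = 0} = vec.span {v, w}"
proof -
  define L where "L = {u. (\<Sum>k\<in>UNIV. g $ k * u $ k) = 0}"
  have sub: "vec.subspace L"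
    unfolding vec.subspace_def L_def
    by (auto simp: sum_3 algebra_simps) (metis (no_types, lifting) distrib_left mult.left_commute mult_zero_right)
  have vw: "v \<in> L" "w \<in> L" using assms by (auto simp: L_def)
  have "u \<in> vec.span {v, w}" if u: "u \<in> L" for u
  proof (rule ccontr)
    assume nu: "u \<notin> vec.span {v, w}"
    have "vec.independent {w, v}"
      using assms(2,3) by (simp add: vec.independent_insert)
    hence "vec.independent {v, w}" by (subst insert_commute)
    hence ind: "vec.independent {u, v, w}" using nu by (rule vec.independent_insertI[rotated])
    have "w \<noteq> v" using assms(3) by (auto simp: vec.span_base)
    moreover have "u \<noteq> v" "u \<noteq> w" using nu by (auto simp: vec.span_base)
    ultimately have "card {u, v, w} = 3" by simp
    moreover have "vec.dim (UNIV :: (complex ^ 3) set) = 3" by (subst vec_dim_card) simp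
    ultimately have "UNIV \<subseteq> vec.span {u, v, w}"
      using vec.card_ge_dim_independent[OF subset_UNIV ind] by simp
    moreover have "vec.span {u, v, w} \<subseteq> L" using sub u vw by (intro vec.span_minimal) auto
    ultimately have all: "(\<Sum>k\<in>UNIV. g $ k * x $ k) = 0" for x by (auto simp: L_def)
    have "g $ j = 0" for j using all[of "axis j 1"] by (simp add: axis_def if_distrib cong: if_cong)
    thus False using assms(1) by (simp add: vec_eq_iff)
  qed
  moreover have "vec.span {v, w} \<subseteq> L" using sub vw by (intro vec.span_minimal) auto
  ultimately show ?thesis unfolding L_def by blast
qed

text \<open>The definite description behind the contact order denotes a unique number, because all admissible
  choices of vectors give the same order of vanishing.  Euler's relation puts \<open>v\<close> itself on the tangent line.\<close>

lemma contact_order_eq: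
  assumes v: "v \<noteq> 0" "form a b c v = 0" "gradient a b c v \<noteq> 0"
    and w: "polar a b c v w = 0" "w \<notin> vec.span {v}"
  shows "contact_order a b c (vec.span {v}) = Polynomial.order 0 (quartic_along a b c v w)"
proof -
  have "polar a b c v v = 4 * form a b c v"
    unfolding polar_alt quartic_def by algebra
  hence "polar a b c v v = 0" using v by simp
  hence L: "tangent_line a b c (vec.span {v}) = vec.span {v, w}"
    unfolding tangent_line_span[OF v(1)] polar_def
    using kernel_eq_span[of "gradient a b c v" v w] v w by (simp add: polar_def)
  show ?thesis unfolding contact_order_def intersection_mult_def L
  proof (rule the_equality)
    show "\<exists>v' w'. vec.span {v} = vec.span {v'} \<and> vec.span {v, w} = vec.span {v', w'} \<and>
      Polynomial.order 0 (quartic_along a b c v w) = Polynomial.order 0 (quartic_along a b c v' w')" by blast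
  next
    fix m assume "\<exists>v' w'. vec.span {v} = vec.span {v'} \<and> vec.span {v, w} = vec.span {v', w'} \<and>
      m = Polynomial.order 0 (quartic_along a b c v' w')"
    then obtain v' w' where *: "vec.span {v} = vec.span {v'}" "vec.span {v, w} = vec.span {v', w'}"
      "m = Polynomial.order 0 (quartic_along a b c v' w')" by blast
    obtain l where l: "l \<noteq> 0" "v' = l *s v" using *(1) span_eq_iff[OF v(1)] by blast
    have "w' \<in> vec.span {v, w}" unfolding *(2) by (simp add: vec.span_base)
    then obtain n where "w' - n *s w \<in> vec.span {v}"
      by (auto simp: insert_commute[of v w] vec.span_insert)
    then obtain k where "w' - n *s w = k *s v" by (auto simp: vec.span_singleton)
    hence w': "w' = k *s v + n *s w" by (simp add: algebra_simps)
    have "n \<noteq> 0"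
    proof
      assume "n = 0"
      hence "{v', w'} \<subseteq> vec.span {v}" using w' l by (auto simp: vec.span_singleton)
      hence "vec.span {v', w'} \<subseteq> vec.span {v}" by (intro vec.span_minimal) auto
      moreover have "w \<in> vec.span {v', w'}" unfolding *(2)[symmetric] by (simp add: vec.span_base)
      ultimately show False using w(2) by blast
    qed
    thus "m = Polynomial.order 0 (quartic_along a b c v w)"
      unfolding *(3) l(2) w' using order_along_same_line v w l by blast
  qed
qed

section \<open>Contact orders in terms of the conic\<close>

text \<open>The conic, and below its flex and hyperflex conditions, in the affine chart \<open>Z = 1\<close>.\<close>

definition conic :: "complex \<Rightarrow> complex \<Rightarrow> complex \<Rightarrow> complex \<Rightarrow> complex \<Rightarrow> complex" where
  "conic a b c X Y = X ^ 2 + Y ^ 2 + 1 + a * X * Y + b * X + c * Y"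

text \<open>Half the determinant of the symmetric matrix with rows \<open>(2, a, b)\<close>, \<open>(a, 2, c)\<close>, \<open>(b, c, 2)\<close>; it
  vanishes iff the conic is singular.\<close>

definition disc :: "complex \<Rightarrow> complex \<Rightarrow> complex \<Rightarrow> complex" where
  "disc a b c = 4 - a ^ 2 - b ^ 2 - c ^ 2 + a * b * c"

text \<open>Plays the part of the Hessian: at a point of the conic with \<open>X Y \<noteq> 0\<close> it vanishes iff the four points of
  the quartic above are flexes.\<close>

definition flex_form :: "complex \<Rightarrow> complex \<Rightarrow> complex \<Rightarrow> complex \<Rightarrow> complex \<Rightarrow> complex" where
  "flex_form a b c X Y =
     (2 * X + a * Y + b) * (2 * Y + a * X + c) * (2 + b * X + c * Y) + 4 * disc a b c * X * Y"

text \<open>The coefficient of \<open>T\<^sup>3\<close> along the tangent direction of \<open>contact_order_interior\<close>, up to a factor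
  that is nonzero for \<open>X Y \<noteq> 0\<close>.\<close>

definition hyper_form :: "complex \<Rightarrow> complex \<Rightarrow> complex \<Rightarrow> complex \<Rightarrow> complex \<Rightarrow> complex" where
  "hyper_form a b c X Y =
     (let P = 2 * X + a * Y + b; R = 2 * Y + a * X + c
      in 2 * (Y * R ^ 3 - X * P ^ 3) - a * P * R * (Y * R - X * P))"

lemma form_smult: "form a b c (k *s v) = k ^ 4 * form a b c v"
  by (rule expand_along_line(1))

lemma span_in_curve_iff:
  assumes "v \<noteq> 0"
  shows "vec.span {v} \<in> curve a b c \<longleftrightarrow> form a b c v = 0"
proof -
  have "v \<in> vec.span {v}" by (simp add: vec.span_base)
  moreover have "form a b c u = 0" if "form a b c v = 0" "u \<in> vec.span {v}" for u
    using that by (auto simp: vec.span_singleton form_smult simp del: vector_smult_component)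
  ultimately show ?thesis
    unfolding curve_def proj_plane_def using assms by blast
qed

lemma chart_in_curve_iff: "chart x y \<in> curve a b c \<longleftrightarrow> conic a b c (x ^ 2) (y ^ 2) = 0"
  unfolding chart_def span_in_curve_iff[OF vector3_nonzero[OF one_neq_zero]]
  by (simp add: quartic_def conic_def)

lemma proj_plane_cases:
  assumes "p \<in> proj_plane"
  obtains x y where "p = chart x y"
    | x y where "p = vec.span {vector [x, y, 0]}" "(x, y) \<noteq> (0, 0)"
proof -
  obtain v where v: "p = vec.span {v}" "v \<noteq> 0" using assms by (auto simp: proj_plane_def)
  show thesis
  proof (cases "v $ 3 = 0")
    case True
    hence "v = vector [v $ 1, v $ 2, 0]" by (simp add: vec_eq_iff forall_3)
    moreover from this v(2) have "(v $ 1, v $ 2) \<noteq> (0, 0)" by (auto simp: vec_eq_iff forall_3)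
    ultimately show thesis using that(2) v(1) by metis
  next
    case False
    have "vec.span {v} = vec.span {vector [v $ 1 / v $ 3, v $ 2 / v $ 3, 1]}"
      unfolding span_eq_iff[OF v(2)] using False
      by (intro exI[of _ "1 / v $ 3"]) (simp add: vec_eq_iff forall_3)
    thus thesis using that(1) v(1) unfolding chart_def by metis
  qed
qed

lemma vector3_eq_iff:
  "(vector [x, y, z] :: complex ^ 3) = vector [x', y', z'] \<longleftrightarrow> x = x' \<and> y = y' \<and> z = z'"
  by (auto simp: vec_eq_iff forall_3)

text \<open>With \<open>P\<close>, \<open>R\<close>, \<open>S\<close> the partial derivatives of the conic, the direction \<open>w = (x Y R, - y X P, 0)\<close> is
  tangent because the gradient of the quartic is \<open>(2 x P, 2 y R, 2 z S)\<close>.  The coefficient of \<open>T\<^sup>2\<close> along \<open>w\<close>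
  simplifies by two identities valid on the conic: Euler's relation \<open>X P + Y R + S = 0\<close> and the equation
  \<open>P\<^sup>2 + R\<^sup>2 - a P R = - D\<close> of the dual conic.  Contact order above \<open>4\<close> would mean that the
  tangent line is contained in the curve, which contradicts the same relations.\<close>

lemma contact_order_interior:
  assumes "a ^ 2 \<noteq> 4" and D: "disc a b c \<noteq> 0" and nz: "x \<noteq> 0" "y \<noteq> 0"
    and Q: "conic a b c (x ^ 2) (y ^ 2) = 0"
  shows "contact_order a b c (chart x y) =
    (if flex_form a b c (x ^ 2) (y ^ 2) \<noteq> 0 then 2
     else if hyper_form a b c (x ^ 2) (y ^ 2) \<noteq> 0 then 3 else 4)"
proof -
  define X Y where "X = x ^ 2" and "Y = y ^ 2"
  define P R S where "P = 2 * X + a * Y + b" and "R = 2 * Y + a * X + c" and "S = 2 + b * X + c * Y"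
  have XY: "X \<noteq> 0" "Y \<noteq> 0" using nz by (simp_all add: X_def Y_def)
  have Q': "X ^ 2 + Y ^ 2 + 1 + a * X * Y + b * X + c * Y = 0"
    using Q by (simp add: conic_def X_def Y_def)
  have euler: "X * P + Y * R + S = 0"
    using Q' unfolding P_def R_def S_def by algebra
  have dual: "P ^ 2 + R ^ 2 - a * P * R = - disc a b c"
    using Q' unfolding P_def R_def disc_def by algebra
  have PR: "P \<noteq> 0 \<or> R \<noteq> 0" using dual D by auto
  define v :: "complex ^ 3" where "v = vector [x, y, 1]"
  define w :: "complex ^ 3" where "w = vector [x * (Y * R), - y * (X * P), 0]"
  have v0: "v \<noteq> 0" unfolding v_def by (rule vector3_nonzero) simp
  have Fv: "form a b c v = 0"
    using Q by (simp add: v_def quartic_def conic_def)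
  have grad: "gradient a b c v = vector [2 * x * P, 2 * y * R, 2 * S]"
    unfolding gradient_def v_def Let_def P_def R_def S_def X_def Y_def vector3_eq_iff vector_3
    by (simp add: algebra_simps power2_eq_square power3_eq_cube)
  have grad0: "gradient a b c v \<noteq> 0"
    unfolding grad using PR nz by (auto simp: vec_eq_iff forall_3)
  have pol: "polar a b c v w = 0"
    unfolding polar_def grad sum_3 w_def X_def Y_def by (simp add: algebra_simps power2_eq_square)
  have w: "w \<notin> vec.span {v}"
  proof
    assume "w \<in> vec.span {v}"
    then obtain k where "w = k *s v" by (auto simp: vec.span_singleton)
    hence "w = 0" by (auto simp: w_def v_def smult_vector3 vector3_eq_iff vec_eq_iff forall_3)
    thus False using PR XY nz by (auto simp: w_def vec_eq_iff forall_3)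
  qed
  have C: "polar2 a b c v w = - X * Y * (P * R * S + 4 * disc a b c * X * Y)"
  proof -
    have "polar2 a b c v w = 4 * X ^ 2 * Y ^ 2 * (P ^ 2 + R ^ 2 - a * P * R) +
      X ^ 2 * Y * P ^ 2 * (2 * Y + a * X + c) + X * Y ^ 2 * R ^ 2 * (2 * X + a * Y + b)"
      unfolding polar2_def v_def w_def vector_3 X_def Y_def mult_1 mult_zero_right power_zero_numeral
      by algebra
    also have "\<dots> = 4 * X ^ 2 * Y ^ 2 * (P ^ 2 + R ^ 2 - a * P * R) + X * Y * P * R * (X * P + Y * R)"
      unfolding P_def[symmetric] R_def[symmetric] by algebra
    also have "X * P + Y * R = - S" using euler by algebra
    finally show ?thesis unfolding dual by algebra
  qed
  have Dv: "polar a b c w v = 2 * X ^ 2 * Y ^ 2 * (2 * (Y * R ^ 3 - X * P ^ 3) - a * P * R * (Y * R - X * P))"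
    unfolding polar_alt v_def w_def vector_3 X_def Y_def power_zero_numeral mult_zero_right mult_1_right
    by algebra
  have E: "form a b c w = X ^ 2 * Y ^ 2 * (Y ^ 2 * R ^ 4 + X ^ 2 * P ^ 4 + a * X * Y * P ^ 2 * R ^ 2)"
    unfolding w_def vector_3 quartic_def X_def Y_def power_zero_numeral mult_zero_right by algebra
  have K: "flex_form a b c (x ^ 2) (y ^ 2) = P * R * S + 4 * disc a b c * X * Y"
    by (simp add: flex_form_def P_def R_def S_def X_def Y_def)
  have M: "hyper_form a b c (x ^ 2) (y ^ 2) = 2 * (Y * R ^ 3 - X * P ^ 3) - a * P * R * (Y * R - X * P)"
    by (simp add: hyper_form_def Let_def P_def R_def X_def Y_def)
  \<comment> \<open>If the coefficient of \<open>T\<^sup>4\<close> vanishes, \<open>(p, r)\<close> is isotropic for the form \<open>p\<^sup>2 + r\<^sup>2 + a p r\<close>; if that of \<open>T\<^sup>3\<close>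
    vanishes, the gradient \<open>(m, n)\<close> of this form is proportional to \<open>(R, P)\<close>.\<close>
  have E0: "form a b c w \<noteq> 0"
    if K0: "P * R * S + 4 * disc a b c * X * Y = 0"
      and M0: "2 * (Y * R ^ 3 - X * P ^ 3) - a * P * R * (Y * R - X * P) = 0"
  proof
    assume "form a b c w = 0"
    hence E': "Y ^ 2 * R ^ 4 + X ^ 2 * P ^ 4 + a * X * Y * P ^ 2 * R ^ 2 = 0"
      unfolding E using XY by simp
    define p r where "p = X * P ^ 2" and "r = Y * R ^ 2"
    define m n where "m = 2 * p + a * r" and "n = 2 * r + a * p"
    have 1: "p * m + r * n = 0" using E' unfolding m_def n_def p_def r_def by algebra
    have 2: "R * n - P * m = 0" using M0 unfolding m_def n_def p_def r_def by algebra
    have PR0: "P * R \<noteq> 0" using K0 D XY by auto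
    hence pr: "p \<noteq> 0" "r \<noteq> 0" using XY by (auto simp: p_def r_def)
    show False
    proof (cases "m = 0 \<and> n = 0")
      case True
      hence "(4 - a ^ 2) * p = 0" unfolding m_def n_def by algebra
      thus False using pr assms(1) by simp
    next
      case False
      have "(p * R + r * P) * m = 0" "(p * R + r * P) * n = 0" using 1 2 by algebra+
      hence "p * R + r * P = 0" using False by auto
      hence "P * R * S = 0" using euler unfolding p_def r_def by algebra
      hence "4 * disc a b c * X * Y = 0" using K0 by algebra
      thus False using D XY by simp
    qed
  qed
  have along: "quartic_along a b c v w =
    [:0, 0, polar2 a b c v w, polar a b c w v, form a b c w:]"
    unfolding quartic_along_eq Fv pol ..
  have "contact_order a b c (chart x y) = Polynomial.order 0 (quartic_along a b c v w)"
    unfolding chart_def v_def[symmetric] by (rule contact_order_eq[OF v0 Fv grad0 pol w])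
  also have "\<dots> = (if polar2 a b c v w \<noteq> 0 then 2 else if polar a b c w v \<noteq> 0 then 3 else 4)"
    unfolding along using E0 XY unfolding C Dv by (auto simp: order_at_0)
  finally show ?thesis unfolding C Dv K M using XY by simp
qed

text \<open>On the line where the coordinate \<open>j\<close> vanishes, the quartic contains this coordinate only in even
  powers.  Hence the tangent line contains the \<open>j\<close>-th vertex of the coordinate triangle, the restriction to
  it has no odd coefficients, and its leading coefficient is \<open>1\<close>.\<close>

lemma contact_order_on_axis:
  assumes v: "v \<noteq> 0" "form a b c v = 0" "gradient a b c v \<noteq> 0"
    and e: "v $ j = 0"
  shows "contact_order a b c (vec.span {v}) = (if polar2 a b c v (axis j 1) \<noteq> 0 then 2 else 4)"
proof -
  have pol: "polar a b c v (axis j 1) = 0" "polar a b c (axis j 1) v = 0" "form a b c (axis j 1) = 1"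
    using e exhaust_3[of j] unfolding polar_alt quartic_def by (auto simp: axis_def)
  have "axis j 1 \<notin> vec.span {v}"
  proof
    assume "axis j 1 \<in> vec.span {v}"
    then obtain k where "axis j 1 = k *s v" by (auto simp: vec.span_singleton)
    hence "(axis j 1 :: complex ^ 3) $ j = k * v $ j" by simp
    thus False using e by (simp add: axis_def)
  qed
  from contact_order_eq[OF v pol(1) this] show ?thesis
    unfolding quartic_along_eq v pol by (simp add: order_at_0)
qed

lemma contact_order_axis_chart:
  assumes "c ^ 2 \<noteq> 4" and Q: "conic a b c 0 (y ^ 2) = 0"
  shows "contact_order a b c (chart 0 y) = (if a * y ^ 2 + b \<noteq> 0 then 2 else 4)"
proof -
  define v :: "complex ^ 3" where "v = vector [0, y, 1]"
  have v0: "v \<noteq> 0" unfolding v_def by (rule vector3_nonzero) simp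
  have Fv: "form a b c v = 0" using Q by (simp add: v_def quartic_def conic_def)
  have "gradient a b c v \<noteq> 0"
  proof
    assume "gradient a b c v = 0"
    hence "4 * y ^ 3 + 2 * c * y = 0" "4 + 2 * c * y ^ 2 = 0"
      unfolding gradient_def v_def by (simp_all add: vec_eq_iff forall_3 Let_def)
    hence "y * (2 * y ^ 2 + c) = 0" "2 + c * y ^ 2 = 0"
      by algebra+
    moreover from this have "y \<noteq> 0" by auto
    ultimately have "2 * y ^ 2 + c = 0" "2 + c * y ^ 2 = 0" by auto
    hence "c ^ 2 = 4" by algebra
    thus False using assms(1) by simp
  qed
  from contact_order_on_axis[OF v0 Fv this, of 1]
  show ?thesis unfolding chart_def v_def[symmetric]
    by (simp add: v_def polar2_def axis_def)
qed

lemma contact_order_axis_chart':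
  assumes "b ^ 2 \<noteq> 4" and Q: "conic a b c (x ^ 2) 0 = 0"
  shows "contact_order a b c (chart x 0) = (if a * x ^ 2 + c \<noteq> 0 then 2 else 4)"
proof -
  define v :: "complex ^ 3" where "v = vector [x, 0, 1]"
  have v0: "v \<noteq> 0" unfolding v_def by (rule vector3_nonzero) simp
  have Fv: "form a b c v = 0" using Q by (simp add: v_def quartic_def conic_def)
  have "gradient a b c v \<noteq> 0"
  proof
    assume "gradient a b c v = 0"
    hence "4 * x ^ 3 + 2 * b * x = 0" "4 + 2 * b * x ^ 2 = 0"
      unfolding gradient_def v_def by (simp_all add: vec_eq_iff forall_3 Let_def)
    hence "x * (2 * x ^ 2 + b) = 0" "2 + b * x ^ 2 = 0"
      by algebra+
    moreover from this have "x \<noteq> 0" by auto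
    ultimately have "2 * x ^ 2 + b = 0" "2 + b * x ^ 2 = 0" by auto
    hence "b ^ 2 = 4" by algebra
    thus False using assms(1) by simp
  qed
  from contact_order_on_axis[OF v0 Fv this, of 2]
  show ?thesis unfolding chart_def v_def[symmetric]
    by (simp add: v_def polar2_def axis_def)
qed

lemma contact_order_at_infinity:
  assumes "a ^ 2 \<noteq> 4" and nz: "(x, y) \<noteq> (0, 0)"
    and p: "vec.span {vector [x, y, 0]} \<in> curve a b c"
  shows "contact_order a b c (vec.span {vector [x, y, 0]}) = (if b * x ^ 2 + c * y ^ 2 \<noteq> 0 then 2 else 4)"
    and "x ^ 4 + y ^ 4 + a * x ^ 2 * y ^ 2 = 0"
proof -
  define v :: "complex ^ 3" where "v = vector [x, y, 0]"
  have v0: "v \<noteq> 0" using nz by (auto simp: v_def vec_eq_iff forall_3)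
  have Fv: "form a b c v = 0" using p span_in_curve_iff[OF v0] by (simp add: v_def)
  thus F: "x ^ 4 + y ^ 4 + a * x ^ 2 * y ^ 2 = 0" by (simp add: v_def quartic_def)
  have xy: "x \<noteq> 0" "y \<noteq> 0" using F nz by auto
  have "gradient a b c v \<noteq> 0"
  proof
    assume "gradient a b c v = 0"
    hence "4 * x ^ 3 + 2 * a * x * y ^ 2 = 0" "4 * y ^ 3 + 2 * a * x ^ 2 * y = 0"
      unfolding gradient_def v_def by (simp_all add: vec_eq_iff forall_3 Let_def)
    hence "x * (2 * x ^ 2 + a * y ^ 2) = 0" "y * (2 * y ^ 2 + a * x ^ 2) = 0"
      by algebra+
    hence "2 * x ^ 2 + a * y ^ 2 = 0" "2 * y ^ 2 + a * x ^ 2 = 0" using xy by auto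
    hence "(4 - a ^ 2) * x ^ 2 = 0" by algebra
    thus False using assms(1) xy by simp
  qed
  from contact_order_on_axis[OF v0 Fv this, of 3]
  show "contact_order a b c (vec.span {vector [x, y, 0]}) = (if b * x ^ 2 + c * y ^ 2 \<noteq> 0 then 2 else 4)"
    unfolding v_def[symmetric] by (simp add: v_def polar2_def axis_def)
qed

lemma flex_sets_by_contact_order:
  "weierstrass_points a b c = {p \<in> curve a b c. contact_order a b c p \<ge> 3}"
  "ordinary_flexes a b c = {p \<in> curve a b c. contact_order a b c p = 3}"
  "hyperflexes a b c = {p \<in> curve a b c. contact_order a b c p = 4}"
  unfolding ordinary_flexes_def hyperflexes_def weierstrass_points_def by auto

section \<open>Flexes in the normalised case\<close>

text \<open>The quadratic polynomials \<open>q\<close> (for the flexes) and \<open>n\<close> (for the hyperflexes) in \<open>u = s + t\<close>.\<close>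

definition sum_quadratic :: "complex \<Rightarrow> complex \<Rightarrow> complex" where
  "sum_quadratic a u = a * (a + 2) * u ^ 2 + (a + 2) * (5 * a - 6) * u + 2 * (a - 1) * (5 * a - 6)"

definition sum_hyper :: "complex \<Rightarrow> complex \<Rightarrow> complex" where
  "sum_hyper a u = a * (a + 2) * u ^ 2 + 4 * (a + 2) * (a - 1) * u + a * (5 * a - 6)"

text \<open>For \<open>c = b = a k\<close> with \<open>k\<^sup>2 (a - 1) = 1\<close> the substitution \<open>X = k s\<close>, \<open>Y = k t\<close> makes the constant term of
  the conic \<open>k\<^sup>2 (a - 1)\<close> and removes \<open>k\<close> from its equation.\<close>

lemma conic_normalised:
  assumes k: "k ^ 2 * (a - 1) = 1"
  shows "conic a (a * k) (a * k) (k * s) (k * t) =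
         k ^ 2 * ((s + t) ^ 2 + a * (s + t) + a - 1 + (a - 2) * (s * t))"
  unfolding conic_def using k by algebra

text \<open>Here \<open>D = - (a - 2)\<^sup>2 k\<^sup>2\<close>, and \<open>p = s t\<close> is eliminated with the conic.  The factor \<open>s + t + 1\<close> belongs to
  the two points \<open>(0, - 1)\<close> and \<open>(- 1, 0)\<close> on the coordinate axes.\<close>

lemma flex_form_normalised:
  assumes k: "k ^ 2 * (a - 1) = 1"
    and Q: "(s + t) ^ 2 + a * (s + t) + a - 1 + (a - 2) * (s * t) = 0"
  shows "flex_form a (a * k) (a * k) (k * s) (k * t) = k ^ 4 * (s + t + 1) * sum_quadratic a (s + t)"
proof -
  define u p where "u = s + t" and "p = s * t"
  have Q': "(a - 2) * p = - (u ^ 2 + a * u + a - 1)" using Q unfolding u_def p_def by algebra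
  have D: "disc a (a * k) (a * k) = - ((a - 2) ^ 2 * k ^ 2)"
    unfolding disc_def using k by algebra
  have PR: "(2 * s + a * t + a) * (2 * t + a * s + a) = (a + 2) * u ^ 2 + 4 * a * u + 3 * a - 2"
    using Q' unfolding u_def p_def by algebra
  have "flex_form a (a * k) (a * k) (k * s) (k * t) =
    k ^ 4 * ((2 * s + a * t + a) * (2 * t + a * s + a) * (2 * (a - 1) + a * u)) +
    4 * disc a (a * k) (a * k) * k ^ 2 * p"
    unfolding flex_form_def u_def p_def using k by algebra
  also have "\<dots> = k ^ 4 * (((a + 2) * u ^ 2 + 4 * a * u + 3 * a - 2) * (2 * (a - 1) + a * u) - 4 * (a - 2) * ((a - 2) * p))"
    unfolding PR D by algebra
  also have "\<dots> = k ^ 4 * (u + 1) * sum_quadratic a u"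
    unfolding Q' sum_quadratic_def by algebra
  finally show ?thesis unfolding u_def by simp
qed

text \<open>The form is antisymmetric under the exchange of \<open>s\<close> and \<open>t\<close>, hence divisible by \<open>t - s\<close>; the quotient
  is symmetric and is expressed by \<open>P R\<close> and \<open>P + R\<close>, where \<open>P\<close> and \<open>R\<close> are the normalised partial derivatives.\<close>

lemma hyper_form_normalised:
  assumes Q: "(s + t) ^ 2 + a * (s + t) + a - 1 + (a - 2) * (s * t) = 0"
  shows "hyper_form a (a * k) (a * k) (k * s) (k * t) = k ^ 4 * (t - s) * (a - 2) * sum_hyper a (s + t)"
proof -
  define P R where "P = 2 * s + a * t + a" and "R = 2 * t + a * s + a"
  have PR: "P * R = (a + 2) * (s + t) ^ 2 + 4 * a * (s + t) + 3 * a - 2"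
    "P + R = (a + 2) * (s + t) + 2 * a" "P - R = (2 - a) * (s - t)"
    "P ^ 2 + R ^ 2 - a * (P * R) = (a - 2) ^ 2"
    using Q unfolding P_def R_def by algebra+
  have "hyper_form a (a * k) (a * k) (k * s) (k * t) =
    k ^ 4 * (2 * (t * R ^ 3 - s * P ^ 3) - a * P * R * (t * R - s * P))"
    unfolding hyper_form_def Let_def P_def R_def by algebra
  also have "2 * (t * R ^ 3 - s * P ^ 3) =
    (s + t) * (R - P) * (P ^ 2 + R ^ 2 - a * (P * R) + (a + 1) * (P * R)) -
    (s - t) * (P + R) * (P ^ 2 + R ^ 2 - a * (P * R) + (a - 1) * (P * R))"
    by algebra
  also have "t * R - s * P = (t - s) * (2 * (s + t) + a)"
    unfolding P_def R_def by algebra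
  also have "R - P = (a - 2) * (s - t)" using PR(3) by algebra
  also have "(s + t) * ((a - 2) * (s - t)) * (P ^ 2 + R ^ 2 - a * (P * R) + (a + 1) * (P * R)) -
    (s - t) * (P + R) * (P ^ 2 + R ^ 2 - a * (P * R) + (a - 1) * (P * R)) -
    a * P * R * ((t - s) * (2 * (s + t) + a)) = (t - s) * (a - 2) * sum_hyper a (s + t)"
    unfolding PR(2,4) unfolding mult.assoc[of a P R] PR(1) sum_hyper_def by algebra
  finally show ?thesis by (simp add: mult.assoc)
qed

definition normalised_flexes :: "complex \<Rightarrow> (complex \<times> complex) set" where
  "normalised_flexes a = {(s, t). sum_quadratic a (s + t) = 0 \<and>
     (s + t) ^ 2 + a * (s + t) + a - 1 + (a - 2) * (s * t) = 0}"

definition normalised_hyperflexes :: "complex \<Rightarrow> (complex \<times> complex) set" where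
  "normalised_hyperflexes a = {(s, t) \<in> normalised_flexes a. s = t \<or> sum_hyper a (s + t) = 0}"

text \<open>On the conic \<open>(2 - a) s t = (u + 1) (u + a - 1)\<close>, so a zero coordinate means \<open>u = - 1\<close> or
  \<open>u = 1 - a\<close>.  Neither is a root of \<open>q\<close>: the values there are \<open>6 (a - 2)\<^sup>2\<close> and
  \<open>a (a - 1) (a - 2)\<^sup>2\<close>.\<close>

lemma normalised_flexes_iff:
  assumes "a \<noteq> 0" "a \<noteq> 1" "a \<noteq> 2"
    and Q: "(s + t) ^ 2 + a * (s + t) + a - 1 + (a - 2) * (s * t) = 0"
  shows "s \<noteq> 0 \<and> t \<noteq> 0 \<and> (s + t + 1) * sum_quadratic a (s + t) = 0 \<longleftrightarrow> (s, t) \<in> normalised_flexes a"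
proof -
  define u where "u = s + t"
  have Q': "(u + 1) * (u + a - 1) = (2 - a) * (s * t)"
    using Q unfolding u_def by algebra
  have "(u + 1) * (u + a - 1) \<noteq> 0" if "sum_quadratic a u = 0"
  proof
    assume "(u + 1) * (u + a - 1) = 0"
    then consider "u + 1 = 0" | "u + a - 1 = 0" by (auto simp only: mult_eq_0_iff)
    thus False
    proof cases
      case 1
      hence "6 * (a - 2) ^ 2 = 0" using that unfolding sum_quadratic_def by algebra
      thus False using assms(3) by simp
    next
      case 2
      hence "(a - 2) ^ 2 * (a * (a - 1)) = 0" using that unfolding sum_quadratic_def by algebra
      thus False using assms(1-3) by simp
    qed
  qed
  moreover have "u + 1 \<noteq> 0" if "s * t \<noteq> 0" using Q' that assms(3) by auto
  ultimately show ?thesis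
    unfolding normalised_flexes_def u_def[symmetric] using Q Q' by (auto simp: u_def)
qed

lemma card_sum_prod_pairs:
  fixes u p :: complex
  defines "S \<equiv> {(s, t). s + t = u \<and> s * t = p}"
  shows "finite S" and "u ^ 2 = 4 * p \<Longrightarrow> S = {(u / 2, u / 2)}" and "u ^ 2 \<noteq> 4 * p \<Longrightarrow> card S = 2"
    and "u ^ 2 \<noteq> 4 * p \<Longrightarrow> (s, t) \<in> S \<Longrightarrow> s \<noteq> t"
proof -
  define d where "d = csqrt (u ^ 2 - 4 * p)"
  have d: "d ^ 2 = u ^ 2 - 4 * p" by (simp add: d_def)
  have S: "S = {((u + d) / 2, (u - d) / 2), ((u - d) / 2, (u + d) / 2)}"
  proof (intro equalityI subsetI)
    fix q assume "q \<in> S"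
    then obtain s t where q: "q = (s, t)" "s + t = u" "s * t = p" unfolding S_def by auto
    have "(s - t) ^ 2 = d ^ 2" unfolding d q(2,3)[symmetric] by algebra
    hence "s - t = d \<or> s - t = - d" by (simp add: power2_eq_iff)
    thus "q \<in> {((u + d) / 2, (u - d) / 2), ((u - d) / 2, (u + d) / 2)}"
      using q by (auto simp: field_simps)
  next
    have "(u + d) / 2 * ((u - d) / 2) = (u ^ 2 - d ^ 2) / 4" by (simp add: field_simps power2_eq_square)
    hence "(u + d) / 2 * ((u - d) / 2) = p" unfolding d by simp
    moreover have "(u + d) / 2 + (u - d) / 2 = u" by (simp add: field_simps)
    ultimately show "q \<in> S" if "q \<in> {((u + d) / 2, (u - d) / 2), ((u - d) / 2, (u + d) / 2)}" for q
      unfolding S_def using that by (auto simp: mult.commute add.commute)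
  qed
  show "finite S" unfolding S by simp
  show "S = {(u / 2, u / 2)}" if "u ^ 2 = 4 * p"
  proof -
    have "d = 0" using that by (simp add: d_def)
    thus ?thesis unfolding S by simp
  qed
  have "d \<noteq> 0" if "u ^ 2 \<noteq> 4 * p" using that by (simp add: d_def)
  moreover have "(u + d) / 2 = (u - d) / 2 \<longleftrightarrow> d = 0"
    by (simp add: field_simps)
  ultimately show "card S = 2" if "u ^ 2 \<noteq> 4 * p" using that unfolding S by auto
  show "s \<noteq> t" if "u ^ 2 \<noteq> 4 * p" "(s, t) \<in> S"
    using that unfolding S_def by (auto simp: power2_eq_square)
qed

lemma quadratic_roots:
  fixes A B C :: complex
  assumes "A \<noteq> 0" "B ^ 2 - 4 * A * C \<noteq> 0"
  obtains u v where "u \<noteq> v" "\<And>x. A * x ^ 2 + B * x + C = 0 \<longleftrightarrow> x = u \<or> x = v"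
proof -
  define d where "d = csqrt (B ^ 2 - 4 * A * C)"
  have d: "d ^ 2 = B ^ 2 - 4 * A * C" "d \<noteq> 0" using assms(2) by (simp_all add: d_def)
  define u v where "u = (- B + d) / (2 * A)" and "v = (- B - d) / (2 * A)"
  have "u \<noteq> v" using d(2) assms(1) by (simp add: u_def v_def field_simps)
  moreover have "A * x ^ 2 + B * x + C = 0 \<longleftrightarrow> x = u \<or> x = v" for x
  proof -
    have 1: "2 * A * u = - B + d" "2 * A * v = - B - d" using assms(1) by (simp_all add: u_def v_def)
    have "4 * A * (A * x ^ 2 + B * x + C) = (2 * A * x - 2 * A * u) * (2 * A * x - 2 * A * v)"
      unfolding 1 using d(1) by algebra
    also have "\<dots> = 4 * A ^ 2 * ((x - u) * (x - v))" by algebra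
    finally show ?thesis using assms(1) by auto
  qed
  ultimately show thesis by (rule that)
qed

text \<open>A root of \<open>q\<close> with \<open>s = t\<close> also satisfies \<open>r(u) = (a + 2) u\<^sup>2 + 4 a u + 4 (a - 1) = 0\<close>.  Both \<open>q - n\<close> and
  \<open>q - a r\<close> are \<open>a - 2\<close> times a linear polynomial.  Consequently a common
  root of \<open>q\<close> and \<open>n\<close> satisfies \<open>(a + 2) u = 6 - 5 a\<close>, which is a root of \<open>q\<close> only for \<open>5 a = 6\<close>.  A root of \<open>q\<close>
  with \<open>s = t\<close> satisfies \<open>(a + 6) u = - 6 (a - 1)\<close>, an equation with at most one solution; so at
  most one of two distinct roots has this property.\<close>

lemma normalised_flexes_count:
  assumes a: "a \<noteq> 0" "a \<noteq> 1" "a \<noteq> 2" "a \<noteq> - 2"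
  defines "h \<equiv> normalised_hyperflexes a" and "f \<equiv> normalised_flexes a - normalised_hyperflexes a"
  shows "finite h \<and> finite f \<and>
    (card f = 4 \<and> h = {} \<or> card f = 2 \<and> card h = 1 \<or> f = {} \<and> card h = 2)"
proof -
  define p where "p u = - (u ^ 2 + a * u + a - 1) / (a - 2)" for u
  define S where "S u = {(s, t). s + t = u \<and> s * t = p u}" for u
  have flexes: "(s, t) \<in> normalised_flexes a \<longleftrightarrow> sum_quadratic a (s + t) = 0 \<and> (s, t) \<in> S (s + t)" for s t
    unfolding normalised_flexes_def S_def p_def using a(3) by (simp add: field_simps add_eq_0_iff)
  show ?thesis
  proof (cases "5 * a = 6")
    case True
    have sq: "sum_quadratic a u = 0 \<longleftrightarrow> u = 0" for u
    proof -
      have "5 * a - 6 = 0" using True by simp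
      thus ?thesis unfolding sum_quadratic_def using a by (auto simp: add_eq_0_iff2)
    qed
    have "sum_hyper a 0 = 0" using True by (simp add: sum_hyper_def)
    hence "h = S 0" "f = {}"
      unfolding h_def f_def normalised_hyperflexes_def using sq flexes by (auto simp: S_def)
    moreover have "p 0 \<noteq> 0" using a by (simp add: p_def)
    ultimately show ?thesis
      using card_sum_prod_pairs(1,3)[where u = 0 and p = "p 0"] unfolding S_def by simp
  next
    case False
    have disc: "((a + 2) * (5 * a - 6)) ^ 2 - 4 * (a * (a + 2)) * (2 * (a - 1) * (5 * a - 6)) =
      - 3 * ((a + 2) * ((5 * a - 6) * (a - 2) ^ 2))" by algebra
    have a2: "a + 2 \<noteq> 0" using a(4) by (simp add: add_eq_0_iff2)
    have "((a + 2) * (5 * a - 6)) ^ 2 - 4 * (a * (a + 2)) * (2 * (a - 1) * (5 * a - 6)) \<noteq> 0"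
      unfolding disc using a a2 False by simp
    then obtain u v where uv: "u \<noteq> v" "\<And>x. sum_quadratic a x = 0 \<longleftrightarrow> x = u \<or> x = v"
      using quadratic_roots[of "a * (a + 2)" "(a + 2) * (5 * a - 6)" "2 * (a - 1) * (5 * a - 6)"] a a2
      unfolding sum_quadratic_def by auto
    have nh: "sum_hyper a x \<noteq> 0" if "sum_quadratic a x = 0" for x
    proof
      assume "sum_hyper a x = 0"
      hence "(a - 2) * ((a + 2) * x + 5 * a - 6) = 0"
        using that unfolding sum_hyper_def sum_quadratic_def by algebra
      hence "(a + 2) * x + 5 * a - 6 = 0" using a by simp
      hence "(5 * a - 6) * (a - 2) ^ 2 = 0"
        using that unfolding sum_quadratic_def by algebra
      thus False using a False by simp
    qed
    have double: "(a + 6) * x = - 6 * (a - 1)" if "sum_quadratic a x = 0" "x ^ 2 = 4 * p x" for x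
    proof -
      have "(a - 2) * x ^ 2 = - 4 * (x ^ 2 + a * x + a - 1)"
        using that(2) a(3) by (simp add: p_def field_simps)
      hence "(a - 2) * ((a + 6) * x + 6 * (a - 1)) = 0"
        using that(1) unfolding sum_quadratic_def by algebra
      thus ?thesis using a(3) by (simp add: add_eq_0_iff2)
    qed
    have one_double: "\<not> (u ^ 2 = 4 * p u \<and> v ^ 2 = 4 * p v)"
    proof
      assume "u ^ 2 = 4 * p u \<and> v ^ 2 = 4 * p v"
      hence 1: "(a + 6) * u = - 6 * (a - 1)" "(a + 6) * v = - 6 * (a - 1)" using double uv(2) by auto
      have "a + 6 \<noteq> 0" using 1(1) a(2) by auto
      thus False using 1 uv(1) by (metis mult_left_cancel)
    qed
    note S = card_sum_prod_pairs[where p = "p x" and u = x for x, folded S_def]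
    have disj: "S u \<inter> S v = {}" using uv(1) by (auto simp: S_def)
    have f: "f = {(s, t) \<in> S u \<union> S v. s \<noteq> t}" and h: "h = {(s, t) \<in> S u \<union> S v. s = t}"
      unfolding f_def h_def normalised_hyperflexes_def using flexes uv(2) nh by (auto simp: S_def)
    consider "u ^ 2 \<noteq> 4 * p u" "v ^ 2 \<noteq> 4 * p v" | "u ^ 2 = 4 * p u" "v ^ 2 \<noteq> 4 * p v"
      | "u ^ 2 \<noteq> 4 * p u" "v ^ 2 = 4 * p v" using one_double by blast
    thus ?thesis
    proof cases
      case 1
      have "f = S u \<union> S v" "h = {}" unfolding f h using S(4) 1 by auto
      thus ?thesis using S(1,3) 1 disj by (simp add: card_Un_disjoint)
    next
      case 2
      have "f = S v" "h = S u" unfolding f h using S(4)[OF 2(2)] S(2)[OF 2(1)] by auto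
      thus ?thesis using S(1,3) S(2)[OF 2(1)] 2 by simp
    next
      case 3
      have "f = S u" "h = S v" unfolding f h using S(4)[OF 3(1)] S(2)[OF 3(2)] by auto
      thus ?thesis using S(1,3) S(2)[OF 3(2)] 3 by simp
    qed
  qed
qed

section \<open>Counting the orbits in the normalised case\<close>

text \<open>The three possible configurations, as a property of the parameters that can be transported along
  changes of coordinates.\<close>

definition flex_configuration :: "complex \<Rightarrow> complex \<Rightarrow> complex \<Rightarrow> bool" where
  "flex_configuration a b c \<longleftrightarrow>
    weierstrass_points a b c = ordinary_flexes a b c \<union> hyperflexes a b c \<and>
    ((card (ordinary_flexes a b c) = 16 \<and> forms_orbits (ordinary_flexes a b c) {#4, 4, 4, 4#} \<and>
      card (hyperflexes a b c) = 4 \<and> forms_orbits (hyperflexes a b c) {#2, 2#}) \<or>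
     (card (ordinary_flexes a b c) = 8 \<and> forms_orbits (ordinary_flexes a b c) {#4, 4#} \<and>
      card (hyperflexes a b c) = 8 \<and> forms_orbits (hyperflexes a b c) {#2, 2, 4#}) \<or>
     (ordinary_flexes a b c = {} \<and>
      card (hyperflexes a b c) = 12 \<and> forms_orbits (hyperflexes a b c) {#2, 2, 4, 4#}))"

lemma forms_orbits_of_size_4:
  assumes "finite N" "\<forall>q\<in>N. fst q \<noteq> 0 \<and> snd q \<noteq> 0"
  shows "forms_orbits (\<Union> (sq_fibre ` N)) (replicate_mset (card N) 4)"
    and "card (\<Union> (sq_fibre ` N)) = 4 * card N"
proof -
  have N: "(0, 0) \<notin> N" using assms(2) by force
  have "image_mset (\<lambda>q. if fst q = 0 \<or> snd q = 0 then 2 else 4) (mset_set N) = image_mset (\<lambda>q. 4 :: nat) (mset_set N)"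
    by (rule image_mset_cong) (use assms in auto)
  thus "forms_orbits (\<Union> (sq_fibre ` N)) (replicate_mset (card N) 4)"
    using forms_orbits_sq_fibres(1)[OF assms(1) N] by (simp add: image_mset_const_eq)
  have "(\<Sum>q\<in>N. if fst q = 0 \<or> snd q = 0 then 2 else 4) = (\<Sum>q\<in>N. 4 :: nat)"
    by (rule sum.cong) (use assms(2) in auto)
  thus "card (\<Union> (sq_fibre ` N)) = 4 * card N"
    using forms_orbits_sq_fibres(2)[OF assms(1) N] by simp
qed

lemma forms_orbits_with_two_axis_orbits:
  assumes "finite N" "\<forall>q\<in>N. fst q \<noteq> 0 \<and> snd q \<noteq> 0" and k: "k \<noteq> 0"
  shows "forms_orbits (\<Union> (sq_fibre ` ({(0, k), (k, 0)} \<union> N))) ({#2, 2#} + replicate_mset (card N) 4)"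
    and "card (\<Union> (sq_fibre ` ({(0, k), (k, 0)} \<union> N))) = 4 + 4 * card N"
proof -
  define M where "M = {(0, k), (k, 0)} \<union> N"
  have M: "finite M" "(0, 0) \<notin> M" using assms by (force simp: M_def)+
  have ax: "(0, k) \<notin> N" "(k, 0) \<notin> N" using assms(2) by force+
  have m: "mset_set M = {#(0, k), (k, 0)#} + mset_set N"
    unfolding M_def using ax k assms(1) by simp
  have s: "(\<Sum>q\<in>M. f q) = f (0, k) + f (k, 0) + sum f N" for f :: "complex \<times> complex \<Rightarrow> nat"
    unfolding M_def using ax k assms(1) by simp
  have "image_mset (\<lambda>q. if fst q = 0 \<or> snd q = 0 then 2 else 4) (mset_set N) = image_mset (\<lambda>q. 4 :: nat) (mset_set N)"
    by (rule image_mset_cong) (use assms in auto)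
  thus "forms_orbits (\<Union> (sq_fibre ` ({(0, k), (k, 0)} \<union> N))) ({#2, 2#} + replicate_mset (card N) 4)"
    using forms_orbits_sq_fibres(1)[OF M] unfolding m M_def[symmetric] by (simp add: image_mset_const_eq)
  have "(\<Sum>q\<in>N. if fst q = 0 \<or> snd q = 0 then 2 else 4) = (\<Sum>q\<in>N. 4 :: nat)"
    by (rule sum.cong) (use assms(2) in auto)
  thus "card (\<Union> (sq_fibre ` ({(0, k), (k, 0)} \<union> N))) = 4 + 4 * card N"
    using forms_orbits_sq_fibres(2)[OF M] unfolding s M_def[symmetric] by simp
qed

text \<open>The curve has no flexes at infinity here, because \<open>b (x\<^sup>2 + y\<^sup>2) = 0\<close> together with
  \<open>x\<^sup>4 + y\<^sup>4 + a x\<^sup>2 y\<^sup>2 = 0\<close> would give \<open>a = 2\<close>.  All flexes are therefore visible in the chart \<open>z = 1\<close>, and the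
  flexes of either kind are the union of the fibres over the corresponding points of the conic.\<close>

lemma flex_configuration_normalised:
  assumes a: "a \<noteq> 0" "a \<noteq> 1" "a ^ 2 \<noteq> 4" and b: "(a * k) ^ 2 \<noteq> 4" and k: "k ^ 2 * (a - 1) = 1"
  shows "flex_configuration a (a * k) (a * k)"
proof -
  define b where "b = a * k"
  define curve' where "curve' = curve a b b"
  define order' where "order' = contact_order a b b"
  define f h where "f = normalised_flexes a - normalised_hyperflexes a" and "h = normalised_hyperflexes a"
  define scale where "scale q = (k * fst q, k * snd q)" for q :: "complex \<times> complex"
  \<comment> \<open>The base points of the fibres: \<open>N\<close> for the ordinary flexes, \<open>H\<close> for the hyperflexes.\<close>
  define N H where "N = scale ` f" and "H = {(0, - k), (- k, 0)} \<union> scale ` h"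
  have k0: "k \<noteq> 0" using k by auto
  have a2: "a \<noteq> 2" "a \<noteq> - 2" using a(3) by auto
  have disc: "disc a b b \<noteq> 0"
  proof -
    have "disc a b b = - ((a - 2) ^ 2 * k ^ 2)" unfolding disc_def b_def using k by algebra
    thus ?thesis using a2 k0 by simp
  qed
  have h_sub: "h \<subseteq> normalised_flexes a" unfolding h_def normalised_hyperflexes_def by auto
  have flex_nz: "s \<noteq> 0 \<and> t \<noteq> 0" if "(s, t) \<in> normalised_flexes a" for s t
  proof -
    have "(s + t) ^ 2 + a * (s + t) + a - 1 + (a - 2) * (s * t) = 0"
      using that unfolding normalised_flexes_def by simp
    from normalised_flexes_iff[OF a(1,2) a2(1) this] that show ?thesis by blast
  qed
  have scale_mem: "(X, Y) \<in> scale ` T \<longleftrightarrow> (X / k, Y / k) \<in> T" for X Y T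
    unfolding scale_def image_iff using k0 by (force intro: bexI[of _ "(X / k, Y / k)"])
  have inj: "inj_on scale T" for T
    using k0 by (auto simp: inj_on_def scale_def prod_eq_iff)
  have nz: "fst q \<noteq> 0 \<and> snd q \<noteq> 0" if "q \<in> scale ` f \<or> q \<in> scale ` h" for q
    using that flex_nz h_sub k0 by (auto simp: scale_def f_def)
  have interior: "chart x y \<in> curve' \<Longrightarrow> order' (chart x y) =
      (if (x ^ 2, y ^ 2) \<in> scale ` f then 3 else if (x ^ 2, y ^ 2) \<in> scale ` h then 4 else 2)"
    "(x ^ 2, y ^ 2) \<in> scale ` f \<union> scale ` h \<Longrightarrow> chart x y \<in> curve'"
    if xy: "x \<noteq> 0" "y \<noteq> 0" for x y
  proof -
    define s t where "s = x ^ 2 / k" and "t = y ^ 2 / k"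
    have st: "x ^ 2 = k * s" "y ^ 2 = k * t" "s \<noteq> 0" "t \<noteq> 0" using k0 xy by (simp_all add: s_def t_def)
    have cv: "chart x y \<in> curve' \<longleftrightarrow> (s + t) ^ 2 + a * (s + t) + a - 1 + (a - 2) * (s * t) = 0"
      unfolding curve'_def b_def chart_in_curve_iff st conic_normalised[OF k] using k0 by simp
    show "chart x y \<in> curve'" if "(x ^ 2, y ^ 2) \<in> scale ` f \<union> scale ` h"
    proof -
      have "(s, t) \<in> normalised_flexes a"
        using that h_sub by (auto simp: scale_mem s_def t_def f_def)
      thus ?thesis unfolding cv normalised_flexes_def by simp
    qed
    assume "chart x y \<in> curve'"
    hence Q: "(s + t) ^ 2 + a * (s + t) + a - 1 + (a - 2) * (s * t) = 0" and
      C: "conic a b b (x ^ 2) (y ^ 2) = 0"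
      using cv unfolding curve'_def chart_in_curve_iff by auto
    have K: "flex_form a b b (x ^ 2) (y ^ 2) = 0 \<longleftrightarrow> (s, t) \<in> normalised_flexes a"
      unfolding b_def st(1,2) flex_form_normalised[OF k Q] normalised_flexes_iff[OF a(1,2) a2(1) Q, symmetric]
      using st k0 by simp
    have M: "hyper_form a b b (x ^ 2) (y ^ 2) = 0 \<longleftrightarrow> s = t \<or> sum_hyper a (s + t) = 0"
      unfolding b_def st(1,2) hyper_form_normalised[OF Q] using k0 a2 by auto
    show "order' (chart x y) =
      (if (x ^ 2, y ^ 2) \<in> scale ` f then 3 else if (x ^ 2, y ^ 2) \<in> scale ` h then 4 else 2)"
      unfolding order'_def contact_order_interior[OF a(3) disc xy C] K M scale_mem s_def[symmetric] t_def[symmetric]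
      unfolding f_def h_def normalised_hyperflexes_def by auto
  qed
  have axis: "chart 0 y \<in> curve' \<Longrightarrow> order' (chart 0 y) = (if y ^ 2 = - k then 4 else 2)"
      "chart y 0 \<in> curve' \<Longrightarrow> order' (chart y 0) = (if y ^ 2 = - k then 4 else 2)"
      "y ^ 2 = - k \<Longrightarrow> chart 0 y \<in> curve'" "y ^ 2 = - k \<Longrightarrow> chart y 0 \<in> curve'" for y
  proof -
    have *: "a * y ^ 2 + b = 0 \<longleftrightarrow> y ^ 2 = - k"
    proof -
      have "a * y ^ 2 + b = a * (y ^ 2 + k)" unfolding b_def by algebra
      thus ?thesis using a(1) by (auto simp: add_eq_0_iff2)
    qed
    have b4: "b ^ 2 \<noteq> 4" unfolding b_def by (rule b)
    show "chart 0 y \<in> curve' \<Longrightarrow> order' (chart 0 y) = (if y ^ 2 = - k then 4 else 2)"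
      "chart y 0 \<in> curve' \<Longrightarrow> order' (chart y 0) = (if y ^ 2 = - k then 4 else 2)"
      unfolding curve'_def order'_def chart_in_curve_iff *[symmetric]
      using contact_order_axis_chart[OF b4] contact_order_axis_chart'[OF b4] by simp_all
    have "conic a b b 0 (- k) = 0" "conic a b b (- k) 0 = 0"
      using k unfolding conic_def b_def by (simp_all add: algebra_simps power2_eq_square)
    thus "y ^ 2 = - k \<Longrightarrow> chart 0 y \<in> curve'" "y ^ 2 = - k \<Longrightarrow> chart y 0 \<in> curve'"
      unfolding curve'_def chart_in_curve_iff by simp_all
  qed
  have chart_order: "chart x y \<in> curve' \<Longrightarrow> order' (chart x y) =
      (if (x ^ 2, y ^ 2) \<in> N then 3 else if (x ^ 2, y ^ 2) \<in> H then 4 else 2)"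
    "(x ^ 2, y ^ 2) \<in> N \<union> H \<Longrightarrow> chart x y \<in> curve'" for x y
  proof -
    have mem: "(X, Y) \<notin> scale ` f" "(X, Y) \<notin> scale ` h" if "X = 0 \<or> Y = 0" for X Y
      using that nz[of "(X, Y)"] by auto
    have "x = 0 \<and> y = 0 \<longrightarrow> chart x y \<notin> curve'"
      unfolding curve'_def chart_in_curve_iff by (simp add: conic_def)
    moreover have "- k \<noteq> 0" using k0 by simp
    ultimately show "chart x y \<in> curve' \<Longrightarrow> order' (chart x y) =
      (if (x ^ 2, y ^ 2) \<in> N then 3 else if (x ^ 2, y ^ 2) \<in> H then 4 else 2)"
      "(x ^ 2, y ^ 2) \<in> N \<union> H \<Longrightarrow> chart x y \<in> curve'"
      using interior[of x y] axis[of x] axis[of y] k0 unfolding N_def H_def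
      by (cases "x = 0"; cases "y = 0"; auto simp: mem)+
  qed
  have infinite_order: "order' (vec.span {vector [x, y, 0]}) = 2"
    if "vec.span {vector [x, y, 0]} \<in> curve'" "(x, y) \<noteq> (0, 0)" for x y
  proof -
    note inf = contact_order_at_infinity[OF a(3) that(2) that(1)[unfolded curve'_def]]
    have "b * x ^ 2 + b * y ^ 2 \<noteq> 0"
    proof
      assume "b * x ^ 2 + b * y ^ 2 = 0"
      hence "b * (x ^ 2 + y ^ 2) = 0" by algebra
      hence "x ^ 2 = - (y ^ 2)" using a(1) k0 by (simp add: b_def add_eq_0_iff2)
      hence "(a - 2) * y ^ 4 = 0" using inf(2) by algebra
      hence "y = 0" using a2 by simp
      thus False using \<open>x ^ 2 = - (y ^ 2)\<close> that(2) by simp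
    qed
    thus ?thesis using inf(1) unfolding order'_def by simp
  qed
  have point: "order' p \<in> {2, 3, 4} \<and> (order' p = 3 \<longrightarrow> p \<in> \<Union> (sq_fibre ` N)) \<and>
      (order' p = 4 \<longrightarrow> p \<in> \<Union> (sq_fibre ` H))" if p: "p \<in> curve'" for p
  proof -
    have "p \<in> proj_plane" using p unfolding curve'_def curve_def by simp
    thus ?thesis
    proof (cases rule: proj_plane_cases)
      case (1 x y)
      have "p \<in> sq_fibre (x ^ 2, y ^ 2)" unfolding sq_fibre_def 1 by blast
      thus ?thesis using chart_order(1)[of x y] p unfolding 1 by (auto split: if_splits)
    next
      case (2 x y)
      thus ?thesis using infinite_order p by simp
    qed
  qed
  have disj: "N \<inter> H = {}"
  proof -
    have "f \<inter> h = {}" unfolding f_def h_def by auto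
    moreover have "(0, - k) \<notin> N" "(- k, 0) \<notin> N" using nz unfolding N_def by force+
    ultimately show ?thesis
      unfolding N_def H_def using inj_on_image_Int[OF inj[of UNIV], of f h] by auto
  qed
  have fibre_points: "p \<in> curve' \<and> order' p = (if q \<in> N then 3 else 4)"
    if p: "p \<in> sq_fibre q" and q: "q \<in> N \<union> H" for p q
  proof -
    obtain x y where "p = chart x y" "q = (x ^ 2, y ^ 2)"
      using p unfolding sq_fibre_def by auto
    thus ?thesis using chart_order[of x y] q by auto
  qed
  have W: "weierstrass_points a b b = {p \<in> curve'. order' p \<ge> 3}"
    "ordinary_flexes a b b = {p \<in> curve'. order' p = 3}"
    "hyperflexes a b b = {p \<in> curve'. order' p = 4}"
    unfolding curve'_def order'_def by (rule flex_sets_by_contact_order)+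
  have ord: "ordinary_flexes a b b = \<Union> (sq_fibre ` N)"
    unfolding W using point fibre_points by fastforce
  have hyp: "hyperflexes a b b = \<Union> (sq_fibre ` H)"
    unfolding W using point fibre_points disj by fastforce
  have union: "weierstrass_points a b b = ordinary_flexes a b b \<union> hyperflexes a b b"
    unfolding W using point by fastforce
  have fin: "finite f" "finite h" and cases: "card f = 4 \<and> h = {} \<or> card f = 2 \<and> card h = 1 \<or> f = {} \<and> card h = 2"
    using normalised_flexes_count[OF a(1,2) a2] unfolding f_def h_def by blast+
  have cardN: "card (scale ` f) = card f" "card (scale ` h) = card h" using card_image[OF inj] by auto
  have scaled: "finite (scale ` f)" "finite (scale ` h)" "- k \<noteq> 0" using fin k0 by auto
  have nz': "\<forall>q\<in>scale ` f. fst q \<noteq> 0 \<and> snd q \<noteq> 0" "\<forall>q\<in>scale ` h. fst q \<noteq> 0 \<and> snd q \<noteq> 0"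
    using nz by blast+
  have ord_orbits: "forms_orbits (ordinary_flexes a b b) (replicate_mset (card f) 4)"
    "card (ordinary_flexes a b b) = 4 * card f"
    using forms_orbits_of_size_4[OF scaled(1) nz'(1)] unfolding cardN ord N_def .
  have hyper_orbits: "forms_orbits (hyperflexes a b b) ({#2, 2#} + replicate_mset (card h) 4)"
    "card (hyperflexes a b b) = 4 + 4 * card h"
    using forms_orbits_with_two_axis_orbits[OF scaled(2) nz'(2) scaled(3)] unfolding cardN hyp H_def .
  have rep: "replicate_mset 4 (4 :: nat) = {#4, 4, 4, 4#}" "replicate_mset 2 (4 :: nat) = {#4, 4#}"
    by (simp_all add: eval_nat_numeral)
  have rep': "{#2, 2#} + replicate_mset 0 (4 :: nat) = {#2, 2#}"
    "{#2, 2#} + replicate_mset 1 (4 :: nat) = {#2, 2, 4#}"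
    "{#2, 2#} + replicate_mset 2 (4 :: nat) = {#2, 2, 4, 4#}"
    by (simp_all add: eval_nat_numeral add_mset_commute)
  have empty: "ordinary_flexes a b b = {}" if "f = {}" unfolding ord N_def that by simp
  from cases consider "card f = 4" "card h = 0" | "card f = 2" "card h = 1" | "f = {}" "card h = 2" by auto
  thus ?thesis
  proof cases
    case 1
    with union ord_orbits hyper_orbits show ?thesis
      unfolding flex_configuration_def b_def[symmetric] 1 rep rep' by simp
  next
    case 2
    with union ord_orbits hyper_orbits show ?thesis
      unfolding flex_configuration_def b_def[symmetric] 2 rep rep' by simp
  next
    case 3
    with union empty hyper_orbits show ?thesis
      unfolding flex_configuration_def b_def[symmetric] 3 rep' by simp
  qed
qed

section \<open>Changes of coordinates\<close>

lemma poly_quartic_along: "poly (quartic_along a b c v w) t = form a b c (v + t *s w)"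
  unfolding quartic_along_def quartic_def by (simp add: mult.commute)

text \<open>Contact order, tangent lines and the curve are defined by the quartic form alone, so an invertible
  matrix that carries one form to another carries the flexes along; the orbit structure follows if the
  matrix normalises \<open>H\<close>.\<close>

lemma flex_configuration_transport:
  fixes A B :: "complex ^ 3 ^ 3"
  assumes inv: "A ** B = mat 1" "B ** A = mat 1"
    and form: "\<And>v. form a' b' c' (A *v v) = form a b c v"
    and signs: "(\<lambda>D. A ** D) ` sign_matrices = (\<lambda>D. D ** A) ` sign_matrices"
    and "flex_configuration a b c"
  shows "flex_configuration a' b' c'"
proof -
  define G where "G = (`) ((*v) A)"
  have AB: "A *v (B *v v) = v" "B *v (A *v v) = v" for v
    using inv by (simp_all add: matrix_vector_mul_assoc)
  have inj: "inj ((*v) A)" by (metis AB(2) injI)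
  have Gx: "G p = (*v) A ` p" for p by (simp add: G_def)
  have G_iff: "G p = G q \<longleftrightarrow> p = q" for p q unfolding Gx using inj by (rule inj_image_eq_iff)
  have span: "G (vec.span {v}) = vec.span {A *v v}" "G (vec.span {v, w}) = vec.span {A *v v, A *v w}" for v w
    using vec.linear_span_image[of "(*v) A" "{v}"] vec.linear_span_image[of "(*v) A" "{v, w}"]
    unfolding Gx by simp_all
  have along: "quartic_along a' b' c' (A *v v) (A *v w) = quartic_along a b c v w" for v w
    unfolding poly_eq_poly_eq_iff[symmetric] fun_eq_iff poly_quartic_along form[symmetric]
    by (simp add: matrix_vector_right_distrib vector_scalar_commute)
  hence polar: "polar a' b' c' (A *v v) (A *v w) = polar a b c v w" for v w
    unfolding quartic_along_eq by simp
  have A0: "A *v v = 0 \<longleftrightarrow> v = 0" for v by (metis AB(2) matrix_vector_mult_0_right)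
  have plane: "G p \<in> proj_plane \<longleftrightarrow> p \<in> proj_plane" for p
  proof
    assume "G p \<in> proj_plane"
    then obtain v where v: "G p = vec.span {v}" "v \<noteq> 0" unfolding proj_plane_def by auto
    hence "G p = G (vec.span {B *v v})" unfolding span AB by simp
    hence "p = vec.span {B *v v}" unfolding G_iff .
    moreover have "B *v v \<noteq> 0" using v(2) AB(1)[of v] by auto
    ultimately show "p \<in> proj_plane" unfolding proj_plane_def by auto
  next
    assume "p \<in> proj_plane"
    thus "G p \<in> proj_plane" unfolding Gx by (rule proj_plane_image[OF inj])
  qed
  have curve: "G p \<in> curve a' b' c' \<longleftrightarrow> p \<in> curve a b c" for p
    unfolding curve_def using plane[of p] form by (simp add: Gx)
  have tangent: "tangent_line a' b' c' (G p) = G (tangent_line a b c p)" for p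
  proof -
    have "A *v w \<in> tangent_line a' b' c' (G p) \<longleftrightarrow> w \<in> tangent_line a b c p" for w
      unfolding tangent_line_def polar_def[symmetric] Gx by (simp add: polar)
    thus ?thesis unfolding Gx by (auto simp: image_iff) (metis AB(1))
  qed
  have "(\<exists>v w. G p = vec.span {v} \<and> G L = vec.span {v, w} \<and> m = Polynomial.order 0 (quartic_along a' b' c' v w))
    \<longleftrightarrow> (\<exists>v w. p = vec.span {v} \<and> L = vec.span {v, w} \<and> m = Polynomial.order 0 (quartic_along a b c v w))"
    (is "?l \<longleftrightarrow> ?r") for p L m
  proof
    assume ?l
    then obtain v w where "G p = vec.span {v}" "G L = vec.span {v, w}"
      "m = Polynomial.order 0 (quartic_along a' b' c' v w)" by blast
    hence "G p = G (vec.span {B *v v})" "G L = G (vec.span {B *v v, B *v w})"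
      "m = Polynomial.order 0 (quartic_along a b c (B *v v) (B *v w))"
      unfolding span along[symmetric] AB by auto
    thus ?r unfolding G_iff by blast
  next
    assume ?r
    then obtain v w where "G p = G (vec.span {v})" "G L = G (vec.span {v, w})"
      "m = Polynomial.order 0 (quartic_along a b c v w)" by blast
    thus ?l unfolding span along[symmetric] by blast
  qed
  hence contact: "contact_order a' b' c' (G p) = contact_order a b c p" for p
    unfolding contact_order_def intersection_mult_def tangent by simp
  have surj: "\<exists>q. p = G q" for p
    using AB(1) by (intro exI[of _ "(*v) B ` p"]) (simp add: Gx image_image)
  have image: "{p \<in> curve a' b' c'. R (contact_order a' b' c' p)} = G ` {p \<in> curve a b c. R (contact_order a b c p)}" for R
  proof (intro equalityI subsetI)
    fix p assume p: "p \<in> {p \<in> curve a' b' c'. R (contact_order a' b' c' p)}"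
    obtain q where "p = G q" using surj by blast
    with p show "p \<in> G ` {p \<in> curve a b c. R (contact_order a b c p)}"
      by (simp add: curve contact)
  next
    fix p assume "p \<in> G ` {p \<in> curve a b c. R (contact_order a b c p)}"
    thus "p \<in> {p \<in> curve a' b' c'. R (contact_order a' b' c' p)}"
      by (auto simp only: curve contact mem_Collect_eq)
  qed
  note W = flex_sets_by_contact_order
  have sets: "weierstrass_points a' b' c' = G ` weierstrass_points a b c"
    "ordinary_flexes a' b' c' = G ` ordinary_flexes a b c"
    "hyperflexes a' b' c' = G ` hyperflexes a b c"
    unfolding W using image[of "\<lambda>m. m \<ge> 3"] image[of "\<lambda>m. m = 3"] image[of "\<lambda>m. m = 4"] .
  have "inj G" by (rule injI) (simp add: G_iff)
  hence card: "card (G ` S) = card S" for S by (simp add: card_image inj_on_subset)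
  have plane_sub: "ordinary_flexes a b c \<subseteq> proj_plane" "hyperflexes a b c \<subseteq> proj_plane"
    unfolding W curve_def by auto
  have orbits: "forms_orbits (ordinary_flexes a b c) M \<Longrightarrow> forms_orbits (G ` ordinary_flexes a b c) M"
    "forms_orbits (hyperflexes a b c) M \<Longrightarrow> forms_orbits (G ` hyperflexes a b c) M" for M
    unfolding G_def
    by (rule forms_orbits_image[OF inj signs plane_sub(1)], assumption)
      (rule forms_orbits_image[OF inj signs plane_sub(2)], assumption)
  show ?thesis
    using assms(5) unfolding flex_configuration_def sets card
    by (elim conjE disjE) (simp_all only: image_Un image_is_empty orbits simp_thms)
qed

text \<open>Conjugation by \<open>A\<close> is the map \<open>\<rho>\<close> on sign matrices, given in terms of the three signs.\<close>

lemma sign_matrices_normalised: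
  assumes comm: "\<And>e f g. A ** diag3 e f g = \<rho> (e, f, g) ** A"
    and perm: "\<rho> ` (S \<times> S \<times> S) = (\<lambda>(e, f, g). diag3 e f g) ` (S \<times> S \<times> S)"
    and S: "S = {1, - 1}"
  shows "(\<lambda>D. A ** D) ` sign_matrices = (\<lambda>D. D ** A) ` sign_matrices"
proof -
  have signs: "sign_matrices = (\<lambda>(e, f, g). diag3 e f g) ` (S \<times> S \<times> S)"
    unfolding sign_matrices_def S by (auto simp: image_iff)
  have "(\<lambda>D. A ** D) ` sign_matrices = (\<lambda>q. \<rho> q ** A) ` (S \<times> S \<times> S)"
    unfolding signs image_image using comm by (intro image_cong) auto
  also have "\<dots> = (\<lambda>D. D ** A) ` \<rho> ` (S \<times> S \<times> S)" by (simp add: image_image)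
  finally show ?thesis unfolding perm signs .
qed

lemmas matrix3_simps = vec_eq_iff forall_3 matrix_matrix_mult_def mat_def sum_3 diag3_def

lemma flex_configuration_swap_yz:
  assumes "flex_configuration a b c"
  shows "flex_configuration b a c"
proof (rule flex_configuration_transport[OF _ _ _ _ assms])
  define A :: "complex ^ 3 ^ 3" where "A = vector [vector [1, 0, 0], vector [0, 0, 1], vector [0, 1, 0]]"
  show "A ** A = mat 1" "A ** A = mat 1" by (simp_all add: A_def matrix3_simps)
  show "form b a c (A *v v) = form a b c v" for v
    by (simp add: A_def matrix_vector_mult_def sum_3 quartic_def algebra_simps)
  have "A ** diag3 e f g = diag3 e g f ** A" for e f g by (simp add: A_def matrix3_simps)
  thus "(\<lambda>D. A ** D) ` sign_matrices = (\<lambda>D. D ** A) ` sign_matrices"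
    by (intro sign_matrices_normalised[where \<rho> = "(\<lambda>(e, f, g). diag3 e g f)" and S = "{1, - 1}"])
      (auto simp: image_iff)
qed

lemma flex_configuration_swap_xz:
  assumes "flex_configuration a b c"
  shows "flex_configuration c b a"
proof (rule flex_configuration_transport[OF _ _ _ _ assms])
  define A :: "complex ^ 3 ^ 3" where "A = vector [vector [0, 0, 1], vector [0, 1, 0], vector [1, 0, 0]]"
  show "A ** A = mat 1" "A ** A = mat 1" by (simp_all add: A_def matrix3_simps)
  show "form c b a (A *v v) = form a b c v" for v
    by (simp add: A_def matrix_vector_mult_def sum_3 quartic_def algebra_simps)
  have "A ** diag3 e f g = diag3 g f e ** A" for e f g by (simp add: A_def matrix3_simps)
  thus "(\<lambda>D. A ** D) ` sign_matrices = (\<lambda>D. D ** A) ` sign_matrices"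
    by (intro sign_matrices_normalised[where \<rho> = "(\<lambda>(e, f, g). diag3 g f e)" and S = "{1, - 1}"])
      (auto simp: image_iff)
qed

lemma flex_configuration_negate:
  assumes "flex_configuration a b c"
  shows "flex_configuration (- a) b (- c)"
proof (rule flex_configuration_transport[OF _ _ _ _ assms])
  define A where "A = diag3 1 \<i> 1"
  show "A ** diag3 1 (- \<i>) 1 = mat 1" "diag3 1 (- \<i>) 1 ** A = mat 1"
    by (simp_all add: A_def matrix3_simps)
  show "form (- a) b (- c) (A *v v) = form a b c v" for v
    by (simp add: A_def diag3_mult quartic_def power_mult_distrib)
  have "A ** diag3 e f g = diag3 e f g ** A" for e f g by (simp add: A_def matrix3_simps mult.commute)
  thus "(\<lambda>D. A ** D) ` sign_matrices = (\<lambda>D. D ** A) ` sign_matrices"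
    by (intro sign_matrices_normalised[where \<rho> = "\<lambda>(e, f, g). diag3 e f g" and S = "{1, - 1}"]) auto
qed

text \<open>The two equations give \<open>b\<^sup>2 = c\<^sup>2\<close>, and the case \<open>c = - b\<close> reduces to \<open>c = b\<close> by changing the signs of \<open>a\<close>
  and \<open>c\<close>.  In the case \<open>c = b\<close> the number \<open>k = b / a\<close> satisfies \<open>k\<^sup>2 (a - 1) = 1\<close>.\<close>

lemma flex_configuration_P12:
  assumes adm: "admissible a b c" and nz: "(a, b, c) \<noteq> (0, 0, 0)"
    and P: "a ^ 2 + b ^ 2 - a * b * c = 0" "a ^ 2 + c ^ 2 - a * b * c = 0"
  shows "flex_configuration a b c"
proof -
  have bounds: "a ^ 2 \<noteq> 1" "a ^ 2 \<noteq> 4" "b ^ 2 \<noteq> 4" using adm unfolding admissible_def by auto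
  have "b ^ 2 = c ^ 2" using P by algebra
  hence bc: "c = b \<or> c = - b" by (auto simp: power2_eq_iff)
  have a0: "a \<noteq> 0"
  proof
    assume "a = 0"
    hence "b ^ 2 = 0" "c ^ 2 = 0" using P by simp_all
    thus False using nz \<open>a = 0\<close> by simp
  qed
  have equal: "flex_configuration a' b b" if "a' ^ 2 = a ^ 2" "a' ^ 2 + b ^ 2 - a' * b ^ 2 = 0" for a'
  proof -
    define k where "k = b / a'"
    have a': "a' \<noteq> 0" "a' \<noteq> 1" "a' ^ 2 \<noteq> 4" using that(1) a0 bounds by auto
    have b: "b = a' * k" using a' by (simp add: k_def)
    have "a' ^ 2 * (k ^ 2 * (a' - 1) - 1) = 0" using that(2) unfolding b by algebra
    hence "k ^ 2 * (a' - 1) = 1" using a' by simp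
    from flex_configuration_normalised[OF a' _ this] show ?thesis using b bounds by simp
  qed
  from bc show ?thesis
  proof
    assume "c = b"
    have "a ^ 2 + b ^ 2 - a * b ^ 2 = 0" using P(1) unfolding \<open>c = b\<close> by algebra
    thus ?thesis using equal[of a] \<open>c = b\<close> by simp
  next
    assume c: "c = - b"
    have "(- a) ^ 2 = a ^ 2" "(- a) ^ 2 + b ^ 2 - (- a) * b ^ 2 = 0" using P(1) unfolding c by (simp_all add: power2_eq_square mult.assoc)
    hence "flex_configuration (- a) b b" by (rule equal)
    from flex_configuration_negate[OF this] show ?thesis unfolding c by simp
  qed
qed

lemma admissible_permute:
  assumes "admissible a b c"
  shows "admissible b a c" "admissible c b a"
proof -
  have e: "b ^ 2 + a ^ 2 + c ^ 2 - b * a * c = a ^ 2 + b ^ 2 + c ^ 2 - a * b * c"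
    "c ^ 2 + b ^ 2 + a ^ 2 - c * b * a = a ^ 2 + b ^ 2 + c ^ 2 - a * b * c" by algebra+
  show "admissible b a c" "admissible c b a"
    using assms unfolding admissible_def e mult_eq_0_iff by blast+
qed

theorem theorem3p8:
  fixes a b c :: complex and i j :: nat
  assumes "admissible a b c"
    and "(a, b, c) \<noteq> (0, 0, 0)"
    and "i \<in> {1, 2, 3}" and "j \<in> {1, 2, 3}" and "i \<noteq> j"
    and "P_param i a b c = 0" and "P_param j a b c = 0"
  shows "weierstrass_points a b c = ordinary_flexes a b c \<union> hyperflexes a b c \<and>
    ((card (ordinary_flexes a b c) = 16 \<and> forms_orbits (ordinary_flexes a b c) {#4, 4, 4, 4#} \<and>
      card (hyperflexes a b c) = 4 \<and> forms_orbits (hyperflexes a b c) {#2, 2#}) \<or>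
     (card (ordinary_flexes a b c) = 8 \<and> forms_orbits (ordinary_flexes a b c) {#4, 4#} \<and>
      card (hyperflexes a b c) = 8 \<and> forms_orbits (hyperflexes a b c) {#2, 2, 4#}) \<or>
     (ordinary_flexes a b c = {} \<and>
      card (hyperflexes a b c) = 12 \<and> forms_orbits (hyperflexes a b c) {#2, 2, 4, 4#}))"
proof -
  define P1 P2 P3 where "P1 = a ^ 2 + b ^ 2 - a * b * c" and "P2 = a ^ 2 + c ^ 2 - a * b * c"
    and "P3 = b ^ 2 + c ^ 2 - a * b * c"
  have P: "P_param 1 a b c = P1" "P_param 2 a b c = P2" "P_param 3 a b c = P3"
    by (simp_all add: P_param_def P1_def P2_def P3_def)
  have "P1 = 0 \<and> P2 = 0 \<or> P1 = 0 \<and> P3 = 0 \<or> P3 = 0 \<and> P2 = 0"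
    using assms(3-7) P by (elim insertE emptyE) simp_all
  then consider "P1 = 0" "P2 = 0" | "P1 = 0" "P3 = 0" | "P3 = 0" "P2 = 0" by blast
  hence "flex_configuration a b c"
  proof cases
    case 1
    thus ?thesis using flex_configuration_P12[OF assms(1,2)] by (simp add: P1_def P2_def)
  next
    case 2
    have "b ^ 2 + a ^ 2 - b * a * c = 0" "b ^ 2 + c ^ 2 - b * a * c = 0"
      using 2 unfolding P1_def P3_def by algebra+
    moreover have "(b, a, c) \<noteq> (0, 0, 0)" using assms(2) by auto
    ultimately have "flex_configuration b a c"
      using flex_configuration_P12[OF admissible_permute(1)[OF assms(1)]] by blast
    thus ?thesis by (rule flex_configuration_swap_yz)
  next
    case 3
    have "c ^ 2 + b ^ 2 - c * b * a = 0" "c ^ 2 + a ^ 2 - c * b * a = 0"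
      using 3 unfolding P2_def P3_def by algebra+
    moreover have "(c, b, a) \<noteq> (0, 0, 0)" using assms(2) by auto
    ultimately have "flex_configuration c b a"
      using flex_configuration_P12[OF admissible_permute(2)[OF assms(1)]] by blast
    thus ?thesis by (rule flex_configuration_swap_xz)
  qed
  thus ?thesis unfolding flex_configuration_def .
qed

end
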